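(* Let $B_R$ be a geodesic ball of radius $R$ in the hyperbolic space $\mathbf{H}^n$ of constant curvature $-1$, and let $\sigma>\frac{n-1}{2}$. There are positive constants $R_0,c_0$ depending only on $\sigma$ and $n$ such that for all $R\geq R_0$, $$\frac{(n-1)^2}{4}+\frac{\pi^2}{R^2}-\frac{c_0}{R^3}\leq\lambda_1(B_R,\sigma)\leq\frac{(n-1)^2}{4}+\frac{\pi^2}{R^2}+\frac{C}{R^3},$$ where $C=\frac{\pi^2(n^2-1)}{2}\int_0^\infty\frac{r^2}{\sinh^2r}\,dr$; moreover the upper bound holds for all $R>0$ and all $\sigma\in\mathbb{R}$. Consequently, for every $\sigma\in(\frac{n-1}{2},+\infty]$ one has, as $R\to\infty$, $$\lambda_1(B_R,\sigma)=\frac{(n-1)^2}{4}+\frac{\pi^2}{R^2}+O\Big(\frac{1}{R^3}\Big).$$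
   Context: The Laplacian is $\Delta=-\mathrm{div}\nabla$, and $\lambda_1(B_R,\sigma)$ denotes the first eigenvalue of the Robin problem $\Delta u=\lambda u$ on $B_R$, $\partial u/\partial N=\sigma u$ on $\partial B_R$, where $N$ is the inner unit normal; for $\sigma=+\infty$, $\lambda_1(B_R,+\infty)$ denotes the first Dirichlet eigenvalue of $B_R$. *)

theory Defs
  imports "HOL-Analysis.Analysis" "HOL-Library.Landau_Symbols"
begin

(* Hyperbolic space H^n is realised as the Poincare ball model: the open unit ball of
   a Euclidean space 'a of dimension n = DIM('a), with metric g = rho(x)^2 |dx|^2,
   rho(x) = 2/(1-|x|^2).  The geodesic ball B_R centred at the origin (every geodesic
   ball is isometric to it) is the Euclidean ball of radius tanh(R/2). *)

definition pc_factor :: "'a::euclidean_space \<Rightarrow> real" where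
  "pc_factor x = 2 / (1 - (norm x)^2)"

definition geo_ball_radius :: "real \<Rightarrow> real" where
  "geo_ball_radius R = tanh (R / 2)"

(* Positive Laplace-Beltrami operator Delta = - div grad of (H^n, g), in Poincare
   coordinates, given first derivative Du and second derivative D2 of u at x:
   Delta u = - rho^(-2) (Euclidean Laplacian of u) - (n-2) rho^(-1) (x . grad u). *)
definition hyp_laplacian ::
  "('a::euclidean_space \<Rightarrow> 'a \<Rightarrow> real) \<Rightarrow> ('a \<Rightarrow> 'a \<Rightarrow> 'a \<Rightarrow> real) \<Rightarrow> 'a \<Rightarrow> real" where
  "hyp_laplacian Du D2 x =
     - ((\<Sum>b\<in>Basis. D2 x b b) / (pc_factor x)^2)
     - (real DIM('a) - 2) * Du x x / pc_factor x"

(* u is an eigenfunction of the problem  Delta u = lam u in B_R,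
   du/dN = sigma u on dB_R (N the inner unit normal w.r.t. g), for real sigma;
   for sigma = +infinity the boundary condition is the Dirichlet condition u = 0.
   Classical eigenfunctions: u in C^2(B_R) \<inter> C^1(closure B_R), not identically 0. *)
definition robin_eigenfunction ::
  "real \<Rightarrow> ereal \<Rightarrow> real \<Rightarrow> ('a::euclidean_space \<Rightarrow> real) \<Rightarrow> bool" where
  "robin_eigenfunction R \<sigma> lam u \<longleftrightarrow>
     (let r = geo_ball_radius R in
      \<exists>S Du D2. open S \<and> cball 0 r \<subseteq> S \<and> S \<subseteq> ball 0 1 \<and>
        (\<forall>x\<in>S. (u has_derivative Du x) (at x)) \<and>
        (\<forall>b\<in>Basis. continuous_on S (\<lambda>x. Du x b)) \<and>
        (\<forall>x\<in>ball 0 r. \<forall>b\<in>Basis. ((\<lambda>y. Du y b) has_derivative D2 x b) (at x)) \<and>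
        (\<forall>b\<in>Basis. \<forall>c\<in>Basis. continuous_on (ball 0 r) (\<lambda>x. D2 x b c)) \<and>
        (\<exists>x\<in>ball 0 r. u x \<noteq> 0) \<and>
        (\<forall>x\<in>ball 0 r. hyp_laplacian Du D2 x = lam * u x) \<and>
        (if \<sigma> = \<infinity> then (\<forall>x\<in>sphere 0 r. u x = 0)
         else (\<forall>x\<in>sphere 0 r.
                 - Du x x / (r * pc_factor x) = real_of_ereal \<sigma> * u x)))"

definition lambda1 :: "'a::euclidean_space itself \<Rightarrow> real \<Rightarrow> ereal \<Rightarrow> real" where
  "lambda1 _ R \<sigma> = Inf {lam. \<exists>u::'a \<Rightarrow> real. robin_eigenfunction R \<sigma> lam u}"

end

theory Submission
  imports Defs "HOL-Real_Asymp.Real_Asymp"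
begin

text \<open>
  Write \<open>m = n - 1\<close> and \<open>s = |x|\<^sup>2\<close> in the Poincare ball.

  Lower bounds for all eigenvalues come from a pointwise maximum principle: if a positive radial
  \<open>\<psi>\<close> satisfies \<open>\<Delta> \<psi> \<ge> \<mu> \<psi>\<close> and \<open>\<partial>\<psi>/\<partial>N < \<sigma> \<psi>\<close> on the boundary, every eigenvalue is at
  least \<open>\<mu>\<close>. The function \<open>\<psi> = cosh (r/2) powr (-m) * sin (k (8 + 2 ln (cosh (r/2))))\<close> with
  \<open>k = \<pi> / (R + a + 8)\<close> is such a barrier for \<open>\<mu> = m\<^sup>2/4 + k\<^sup>2\<close>, because all error terms are
  multiples of \<open>sech\<^sup>2 (r/2)\<close>; here \<open>cosh\<^sup>2 (r/2) = 1/(1 - s)\<close>.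

  For the upper bound the radial solution of \<open>\<Delta> u = l u\<close> regular at the origin is a power series
  in \<open>s\<close>, jointly continuous in \<open>l\<close>. If no \<open>l \<le> \<Lambda>\<close> satisfied the boundary condition, the solution
  for \<open>l = \<Lambda>\<close> would be positive on the closed ball, and Picone's identity with the test function
  \<open>sinh r powr (-m/2) * sin (\<pi> r / R)\<close> bounds \<open>\<Lambda>\<close> from above.
\<close>

section \<open>Maximum principle for radial barriers\<close>

text \<open>\<open>lambda1\<close> is an infimum over all classical eigenfunctions, radial or not,
  and comes with no Rayleigh quotient. This shapes both bounds. The lower one has to hold for every
  eigenvalue, which a pointwise comparison achieves without any knowledge of the first
  eigenfunction. The upper one needs a genuine eigenfunction, since a test function alone yields no
  element of the set. That eigenfunction also makes the set nonempty, and a separate exponential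
  barrier bounds it below; without these two facts the real \<open>Inf\<close> would carry no
  information.

  The variable \<open>s\<close> is used because functions smooth in \<open>s\<close> are smooth at
  the origin, where the equation in \<open>r\<close> is singular, and because the radial operator
  then has polynomial coefficients. In the sine barrier the shift 8 controls the cosine near the
  origin and \<open>a\<close> leaves room at the boundary. For finite \<open>\<sigma>\<close> the
  choice is \<open>a = 1 / (\<sigma> - m / 2)\<close>, whence the dependence of the lower bound on
  \<open>\<sigma>\<close>.\<close>

definition radial_laplacian :: "real \<Rightarrow> real \<Rightarrow> real \<Rightarrow> real \<Rightarrow> real" where
  "radial_laplacian n s p1 p2 =
     - (s * (1 - s)\<^sup>2 * p2 + (n / 2 * (1 - s)\<^sup>2 + (n - 2) * s * (1 - s)) * p1)"

lemma radial_has_derivative: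
  fixes x :: "'a::euclidean_space"
  assumes "(P has_real_derivative p1) (at ((norm x)\<^sup>2))"
  shows "((\<lambda>y. P ((norm y)\<^sup>2)) has_derivative (\<lambda>h. 2 * p1 * (x \<bullet> h))) (at x)"
proof -
  have "((\<lambda>y::'a. (norm y)\<^sup>2) has_derivative (\<lambda>h. 2 * (x \<bullet> h))) (at x)"
    unfolding power2_norm_eq_inner by (auto intro!: derivative_eq_intros simp: inner_commute)
  then have "((P \<circ> (\<lambda>y. (norm y)\<^sup>2)) has_derivative ((*) p1 \<circ> (\<lambda>h. 2 * (x \<bullet> h)))) (at x)"
    using assms by (intro diff_chain_at) (auto simp: has_field_derivative_def)
  then show ?thesis
    by (simp add: o_def mult.left_commute mult.assoc)
qed

lemma radial_has_second_derivative:
  fixes x b :: "'a::euclidean_space"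
  assumes "(P1 has_real_derivative p2) (at ((norm x)\<^sup>2))"
  shows "((\<lambda>y. 2 * P1 ((norm y)\<^sup>2) * (y \<bullet> b)) has_derivative
    (\<lambda>h. 4 * p2 * (x \<bullet> h) * (x \<bullet> b) + 2 * P1 ((norm x)\<^sup>2) * (h \<bullet> b))) (at x)"
  by (auto intro!: derivative_eq_intros radial_has_derivative[OF assms] simp: algebra_simps)

lemma hyp_laplacian_radial:
  fixes x :: "'a::euclidean_space"
  assumes "norm x < 1"
  shows "hyp_laplacian (\<lambda>x h. 2 * P1 ((norm x)\<^sup>2) * (x \<bullet> h))
      (\<lambda>x b h. 4 * P2 ((norm x)\<^sup>2) * (x \<bullet> h) * (x \<bullet> b) + 2 * P1 ((norm x)\<^sup>2) * (h \<bullet> b)) x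
    = radial_laplacian (real DIM('a)) ((norm x)\<^sup>2) (P1 ((norm x)\<^sup>2)) (P2 ((norm x)\<^sup>2))"
proof -
  define s where "s = (norm x)\<^sup>2"
  have s: "s < 1"
    using assms by (simp add: s_def power_less_one_iff abs_square_less_1)
  have "(\<Sum>b\<in>Basis. 4 * P2 s * (x \<bullet> b) * (x \<bullet> b) + 2 * P1 s * (b \<bullet> b))
      = 4 * P2 s * (\<Sum>b\<in>Basis. (x \<bullet> b) * (x \<bullet> b)) + 2 * P1 s * real DIM('a)"
    by (simp add: sum.distrib sum_distrib_left algebra_simps inner_Basis)
  also have "(\<Sum>b\<in>Basis. (x \<bullet> b) * (x \<bullet> b)) = s"
    unfolding s_def power2_norm_eq_inner by (simp add: euclidean_inner[of x x])
  finally have sum: "(\<Sum>b\<in>Basis. 4 * P2 s * (x \<bullet> b) * (x \<bullet> b) + 2 * P1 s * (b \<bullet> b))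
      = 4 * P2 s * s + 2 * P1 s * real DIM('a)" .
  have "x \<bullet> x = s"
    by (simp add: s_def power2_norm_eq_inner)
  then show ?thesis
    unfolding hyp_laplacian_def radial_laplacian_def pc_factor_def s_def[symmetric] sum
    using s by (simp add: field_simps power2_eq_square)
qed

text \<open>A positive \<open>d\<close> would make \<open>g1\<close> positive just to the right of
  0, hence \<open>g\<close> strictly increasing there. It is applied along each coordinate direction
  through an interior maximum.\<close>

lemma second_deriv_nonpos_at_local_max:
  fixes g g1 :: "real \<Rightarrow> real"
  assumes e: "0 < e" and der: "\<And>t. \<bar>t\<bar> < e \<Longrightarrow> (g has_real_derivative g1 t) (at t)"
    and der2: "(g1 has_real_derivative d) (at 0)"
    and max: "\<And>t. \<bar>t\<bar> < e \<Longrightarrow> g t \<le> g 0"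
  shows "g1 0 = 0" and "d \<le> 0"
proof -
  show g10: "g1 0 = 0"
    by (rule DERIV_local_max[OF der[of 0] e]) (use max e in auto)
  show "d \<le> 0"
  proof (rule ccontr)
    assume "\<not> d \<le> 0"
    then obtain r where r: "r > 0" "\<And>h. 0 < h \<Longrightarrow> h < r \<Longrightarrow> g1 0 < g1 h"
      using DERIV_pos_inc_right[OF der2] by auto
    define t where "t = min r e / 2"
    have t: "0 < t" "t < r" "t < e"
      using r e by (auto simp: t_def)
    have "g 0 < g t"
    proof (rule DERIV_pos_imp_increasing_open[OF t(1)])
      show "\<exists>y. DERIV g x :> y \<and> 0 < y" if "0 < x" "x < t" for x
        using der[of x] r(2)[of x] g10 that t by auto
      show "continuous_on {0..t} g"
        by (rule DERIV_continuous_on[where D=g1], rule DERIV_subset[OF der]) (use t in auto)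
    qed
    then show False
      using max[of t] t by auto
  qed
qed

text \<open>The comparison \<open>u \<le> M \<psi>\<close>, with \<open>M\<close> the maximum of \<open>u / \<psi>\<close>, touches at some point:
  an interior one compares the two Laplacians, a boundary one the two normal derivatives.\<close>

lemma maximum_principle:
  fixes u :: "'a::euclidean_space \<Rightarrow> real" and \<rho> :: real
  assumes \<rho>: "0 < \<rho>" "\<rho> < 1" and S: "open S" "cball 0 \<rho> \<subseteq> S"
    and du: "\<And>x. x \<in> S \<Longrightarrow> (u has_derivative Du x) (at x)"
    and d2u: "\<And>x b. x \<in> ball 0 \<rho> \<Longrightarrow> b \<in> Basis \<Longrightarrow>
      ((\<lambda>y. Du y b) has_derivative D2 x b) (at x)"
    and eq: "\<And>x. x \<in> ball 0 \<rho> \<Longrightarrow> hyp_laplacian Du D2 x = lam * u x"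
    and pos: "x1 \<in> ball 0 \<rho>" "u x1 > 0"
    and dP: "\<And>s. 0 \<le> s \<Longrightarrow> s < 1 \<Longrightarrow> (P has_real_derivative P1 s) (at s)"
    and dP1: "\<And>s. 0 \<le> s \<Longrightarrow> s < 1 \<Longrightarrow> (P1 has_real_derivative P2 s) (at s)"
    and Ppos: "\<And>s. 0 \<le> s \<Longrightarrow> s \<le> \<rho>\<^sup>2 \<Longrightarrow> P s > 0"
    and super: "\<And>s. 0 \<le> s \<Longrightarrow> s < \<rho>\<^sup>2 \<Longrightarrow>
      radial_laplacian (real DIM('a)) s (P1 s) (P2 s) \<ge> \<mu> * P s"
    and lam: "lam < \<mu>"
  obtains x where "x \<in> sphere 0 \<rho>" "u x > 0" "2 * \<rho>\<^sup>2 * P1 (\<rho>\<^sup>2) * u x \<le> Du x x * P (\<rho>\<^sup>2)"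
proof -
  define \<psi> where "\<psi> = (\<lambda>x::'a. P ((norm x)\<^sup>2))"
  define D\<psi> where "D\<psi> = (\<lambda>x h::'a. 2 * P1 ((norm x)\<^sup>2) * (x \<bullet> h))"
  define D2\<psi> where "D2\<psi> = (\<lambda>x b h::'a. 4 * P2 ((norm x)\<^sup>2) * (x \<bullet> h) * (x \<bullet> b)
    + 2 * P1 ((norm x)\<^sup>2) * (h \<bullet> b))"
  have n1: "(norm x)\<^sup>2 < 1" if "norm x \<le> \<rho>" for x :: 'a
    using that \<rho> by (simp add: abs_square_less_1)
  have n2: "(norm x)\<^sup>2 \<le> \<rho>\<^sup>2" if "norm x \<le> \<rho>" for x :: 'a
    using that by (simp add: power_mono)
  have d\<psi>: "(\<psi> has_derivative D\<psi> x) (at x)" if "norm x \<le> \<rho>" for x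
    unfolding \<psi>_def D\<psi>_def by (rule radial_has_derivative) (use n1[OF that] in \<open>auto intro: dP\<close>)
  have d2\<psi>: "((\<lambda>y. D\<psi> y b) has_derivative D2\<psi> x b) (at x)" if "norm x \<le> \<rho>" for x b
    unfolding D\<psi>_def D2\<psi>_def
    by (rule radial_has_second_derivative) (use n1[OF that] in \<open>auto intro: dP1\<close>)
  have \<psi>pos: "\<psi> x > 0" if "norm x \<le> \<rho>" for x
    unfolding \<psi>_def using n2[OF that] by (auto intro: Ppos)
  have "continuous_on (cball 0 \<rho>) (\<lambda>x. u x / \<psi> x)"
  proof (rule continuous_on_divide)
    show "continuous_on (cball 0 \<rho>) u"
      by (rule has_derivative_continuous_on, rule has_derivative_at_withinI, rule du) (use S in auto)
    show "continuous_on (cball 0 \<rho>) \<psi>"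
      by (rule has_derivative_continuous_on, rule has_derivative_at_withinI, rule d\<psi>) auto
  qed (use \<psi>pos in \<open>auto simp: less_imp_neq[symmetric]\<close>)
  then obtain x0 where x0: "x0 \<in> cball 0 \<rho>" "\<And>y. y \<in> cball 0 \<rho> \<Longrightarrow> u y / \<psi> y \<le> u x0 / \<psi> x0"
    using continuous_attains_sup[of "cball (0::'a) \<rho>" "\<lambda>x. u x / \<psi> x"] \<rho> by fastforce
  define M where "M = u x0 / \<psi> x0"
  have "0 < u x1 / \<psi> x1"
    using pos \<psi>pos[of x1] by auto
  then have M: "M > 0"
    using x0(2)[of x1] pos by (auto simp: M_def)
  have ux0: "u x0 = M * \<psi> x0"
    using \<psi>pos[of x0] x0(1) by (auto simp: M_def)
  then have ux0pos: "u x0 > 0"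
    using M \<psi>pos[of x0] x0(1) by auto
  define z where "z = (\<lambda>y. u y - M * \<psi> y)"
  have zmax: "z y \<le> z x0" if "norm y \<le> \<rho>" for y
  proof -
    have "u y / \<psi> y \<le> M"
      using x0(2)[of y] that by (simp add: M_def)
    then show ?thesis
      using \<psi>pos[OF that] ux0 by (simp add: z_def divide_le_eq)
  qed
  have dz: "(z has_derivative (\<lambda>h. Du x h - M * D\<psi> x h)) (at x)" if "norm x \<le> \<rho>" for x
    unfolding z_def by (intro derivative_intros du d\<psi>) (use that S in auto)
  have line: "((\<lambda>t. z (x0 + t *\<^sub>R h)) has_real_derivative
      (Du (x0 + t *\<^sub>R h) h - M * D\<psi> (x0 + t *\<^sub>R h) h)) (at t)"
    if "norm (x0 + t *\<^sub>R h) \<le> \<rho>" for t h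
  proof -
    define A where "A = (\<lambda>h'. Du (x0 + t *\<^sub>R h) h' - M * D\<psi> (x0 + t *\<^sub>R h) h')"
    have A: "(z has_derivative A) (at (x0 + t *\<^sub>R h))"
      using dz[OF that] by (simp add: A_def)
    have "((z \<circ> (\<lambda>t. x0 + t *\<^sub>R h)) has_derivative (A \<circ> (\<lambda>t. t *\<^sub>R h))) (at t)"
      by (rule diff_chain_at) (auto intro!: derivative_eq_intros A)
    moreover have "A \<circ> (\<lambda>t. t *\<^sub>R h) = (*) (A h)"
      using linear_scale[OF has_derivative_linear[OF A]] by (auto simp: mult.commute)
    ultimately show ?thesis
      by (simp add: has_field_derivative_def o_def A_def)
  qed
  show thesis
  proof (cases "norm x0 < \<rho>")
    case True
    define e where "e = \<rho> - norm x0"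
    have e: "e > 0"
      using True by (simp add: e_def)
    have in_ball: "norm (x0 + t *\<^sub>R b) < \<rho>" if "\<bar>t\<bar> < e" "b \<in> Basis" for t b
      using norm_triangle_ineq[of x0 "t *\<^sub>R b"] that by (simp add: e_def)
    have key: "Du x0 b - M * D\<psi> x0 b = 0 \<and> D2 x0 b b - M * D2\<psi> x0 b b \<le> 0" if b: "b \<in> Basis" for b
    proof -
      define A where "A = (\<lambda>h. D2 x0 b h - M * D2\<psi> x0 b h)"
      have A: "((\<lambda>x. Du x b - M * D\<psi> x b) has_derivative A) (at x0)"
        unfolding A_def by (intro derivative_intros d2u d2\<psi>) (use b True in auto)
      then have "((\<lambda>x. Du x b - M * D\<psi> x b) \<circ> (\<lambda>t. x0 + t *\<^sub>R b) has_derivative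
         A \<circ> (\<lambda>t. t *\<^sub>R b)) (at 0)"
        by (intro diff_chain_at) (auto intro!: derivative_eq_intros)
      moreover have "A \<circ> (\<lambda>t. t *\<^sub>R b) = (*) (A b)"
        using linear_scale[OF has_derivative_linear[OF A]] by (auto simp: mult.commute)
      ultimately have d2: "((\<lambda>t. Du (x0 + t *\<^sub>R b) b - M * D\<psi> (x0 + t *\<^sub>R b) b) has_real_derivative
          (D2 x0 b b - M * D2\<psi> x0 b b)) (at 0)"
        by (simp add: has_field_derivative_def o_def A_def)
      have "((\<lambda>t. z (x0 + t *\<^sub>R b)) has_real_derivative
          (Du (x0 + t *\<^sub>R b) b - M * D\<psi> (x0 + t *\<^sub>R b) b)) (at t)" if "\<bar>t\<bar> < e" for t
        by (rule line) (use in_ball[OF that b] in auto)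
      note * = second_deriv_nonpos_at_local_max[OF e this d2]
      have "z (x0 + t *\<^sub>R b) \<le> z (x0 + 0 *\<^sub>R b)" if "\<bar>t\<bar> < e" for t
        using zmax[of "x0 + t *\<^sub>R b"] in_ball[OF that b] by simp
      then show ?thesis
        using *(1)[simplified] *(2) by simp
    qed
    \<comment> \<open>The gradient of \<open>z\<close> vanishes at an interior maximum, so the
      first-order terms of the two Laplacians agree exactly and only the traces of the second
      derivatives remain to be compared.\<close>
    define A where "A = (\<lambda>h. Du x0 h - M * D\<psi> x0 h)"
    have "linear A"
      unfolding A_def using dz[of x0] True by (simp add: has_derivative_linear)
    then have "A x0 = (\<Sum>b\<in>Basis. (x0 \<bullet> b) *\<^sub>R A b)"
      using linear_sum[of A "\<lambda>b. (x0 \<bullet> b) *\<^sub>R b" Basis]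
      by (simp add: euclidean_representation linear_scale)
    then have "A x0 = 0"
      using key by (simp add: A_def)
    then have grad: "Du x0 x0 = M * D\<psi> x0 x0"
      by (simp add: A_def)
    have "(\<Sum>b\<in>Basis. D2 x0 b b) \<le> (\<Sum>b\<in>Basis. M * D2\<psi> x0 b b)"
      using key by (intro sum_mono) auto
    also have "\<dots> = M * (\<Sum>b\<in>Basis. D2\<psi> x0 b b)"
      by (simp add: sum_distrib_left)
    finally have "M * (\<Sum>b\<in>Basis. D2\<psi> x0 b b) / (pc_factor x0)\<^sup>2 \<ge> (\<Sum>b\<in>Basis. D2 x0 b b) / (pc_factor x0)\<^sup>2"
      by (rule divide_right_mono) auto
    then have "hyp_laplacian Du D2 x0 \<ge> M * hyp_laplacian D\<psi> D2\<psi> x0"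
      unfolding hyp_laplacian_def grad by (simp add: algebra_simps)
    moreover have "hyp_laplacian D\<psi> D2\<psi> x0 \<ge> \<mu> * \<psi> x0"
      unfolding D\<psi>_def D2\<psi>_def \<psi>_def using True \<rho>
      by (subst hyp_laplacian_radial) (auto intro!: super power_strict_mono)
    then have "M * hyp_laplacian D\<psi> D2\<psi> x0 \<ge> M * (\<mu> * \<psi> x0)"
      using M by (intro mult_left_mono) auto
    moreover have "hyp_laplacian Du D2 x0 = lam * u x0"
      by (rule eq) (use True in auto)
    ultimately have "\<mu> * u x0 \<le> lam * u x0"
      unfolding ux0 by (simp add: algebra_simps)
    then show thesis
      using lam ux0pos by simp
  next
    case False
    then have nx0: "norm x0 = \<rho>"
      using x0(1) by simp
    have d: "((\<lambda>t. z (x0 + t *\<^sub>R x0)) has_real_derivative (Du x0 x0 - M * D\<psi> x0 x0)) (at 0)"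
      using line[of 0 x0] nx0 by simp
    \<comment> \<open>Moving from \<open>x0\<close> towards the origin stays in the closed ball, so
      \<open>z\<close> cannot increase in that direction; its outward radial derivative is therefore
      nonnegative.\<close>
    have "Du x0 x0 - M * D\<psi> x0 x0 \<ge> 0"
    proof (rule ccontr)
      assume "\<not> ?thesis"
      then obtain r where r: "r > 0" "\<And>h. 0 < h \<Longrightarrow> h < r \<Longrightarrow> z x0 < z (x0 + (-h) *\<^sub>R x0)"
        using DERIV_neg_dec_left[OF d] by auto
      define h where "h = min r 1 / 2"
      have h: "0 < h" "h < r" "h < 1"
        using r by (auto simp: h_def)
      have "x0 + (-h) *\<^sub>R x0 = (1 - h) *\<^sub>R x0"
        by (simp add: algebra_simps)
      then have "norm (x0 + (-h) *\<^sub>R x0) \<le> \<rho>"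
        using h nx0 \<rho> by (simp add: mult_left_le_one_le)
      then show False
        using zmax r(2)[OF h(1,2)] by (meson leD)
    qed
    then have "M * (2 * P1 (\<rho>\<^sup>2) * \<rho>\<^sup>2) \<le> Du x0 x0"
      unfolding D\<psi>_def nx0 by (simp add: power2_norm_eq_inner[symmetric] nx0)
    then have "M * (2 * P1 (\<rho>\<^sup>2) * \<rho>\<^sup>2) * P (\<rho>\<^sup>2) \<le> Du x0 x0 * P (\<rho>\<^sup>2)"
      using Ppos[of "\<rho>\<^sup>2"] by (intro mult_right_mono) auto
    moreover have "u x0 = M * P (\<rho>\<^sup>2)"
      using ux0 by (simp add: \<psi>_def nx0)
    ultimately have "2 * \<rho>\<^sup>2 * P1 (\<rho>\<^sup>2) * u x0 \<le> Du x0 x0 * P (\<rho>\<^sup>2)"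
      by (simp add: algebra_simps)
    then show thesis
      using that[of x0] nx0 ux0pos by simp
  qed
qed

section \<open>Eigenvalues and supersolutions\<close>

lemma tanh_half_bounds:
  fixes R :: real
  assumes "R > 0"
  shows "0 < tanh (R / 2)" "tanh (R / 2) < 1"
  using assms by (auto simp: tanh_real_lt_1)

lemma robin_eigenfunctionE:
  fixes u :: "'a::euclidean_space \<Rightarrow> real"
  assumes "robin_eigenfunction R \<sigma> lam u" and "\<rho> = tanh (R / 2)"
  obtains S Du D2 where "open S" "cball 0 \<rho> \<subseteq> S" "S \<subseteq> ball 0 1"
    "\<And>x. x \<in> S \<Longrightarrow> (u has_derivative Du x) (at x)"
    "\<And>b. b \<in> Basis \<Longrightarrow> continuous_on S (\<lambda>x. Du x b)"
    "\<And>x b. x \<in> ball 0 \<rho> \<Longrightarrow> b \<in> Basis \<Longrightarrow> ((\<lambda>y. Du y b) has_derivative D2 x b) (at x)"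
    "\<And>b c. b \<in> Basis \<Longrightarrow> c \<in> Basis \<Longrightarrow> continuous_on (ball 0 \<rho>) (\<lambda>x. D2 x b c)"
    "\<exists>x\<in>ball 0 \<rho>. u x \<noteq> 0"
    "\<And>x. x \<in> ball 0 \<rho> \<Longrightarrow> hyp_laplacian Du D2 x = lam * u x"
    "\<And>x. \<sigma> = \<infinity> \<Longrightarrow> x \<in> sphere 0 \<rho> \<Longrightarrow> u x = 0"
    "\<And>x. \<sigma> \<noteq> \<infinity> \<Longrightarrow> x \<in> sphere 0 \<rho> \<Longrightarrow>
       - Du x x / (\<rho> * pc_factor x) = real_of_ereal \<sigma> * u x"
  using assms(1) unfolding robin_eigenfunction_def geo_ball_radius_def Let_def assms(2)[symmetric]
  apply (elim exE conjE)
  subgoal for S Du D2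
    by (rule that[of S Du D2]) (simp_all split: if_splits)
  done

text \<open>On the sphere \<open>pc_factor\<close> equals \<open>2 / (1 - \<rho>\<^sup>2)\<close>,
  so the inner normal derivative of the barrier is
  \<open>- \<rho> * (1 - \<rho>\<^sup>2) * P1 (\<rho>\<^sup>2)\<close>, and \<open>bdry\<close> says
  that it is strictly below \<open>\<sigma>\<close> times the barrier. If
  \<open>lam < \<mu>\<close>, the boundary point given by the maximum principle is impossible:
  \<open>u\<close> vanishes there in the Dirichlet case, and \<open>bdry\<close> is violated in the
  Robin case.\<close>

lemma robin_eigenvalue_ge_of_positive_eigenfunction:
  fixes u :: "'a::euclidean_space \<Rightarrow> real"
  assumes R: "R > 0" and \<rho>: "\<rho> = tanh (R / 2)"
    and u: "robin_eigenfunction R \<sigma> lam u" and pos: "x1 \<in> ball 0 \<rho>" "u x1 > 0"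
    and dP: "\<And>s. 0 \<le> s \<Longrightarrow> s < 1 \<Longrightarrow> (P has_real_derivative P1 s) (at s)"
    and dP1: "\<And>s. 0 \<le> s \<Longrightarrow> s < 1 \<Longrightarrow> (P1 has_real_derivative P2 s) (at s)"
    and Ppos: "\<And>s. 0 \<le> s \<Longrightarrow> s \<le> \<rho>\<^sup>2 \<Longrightarrow> P s > 0"
    and super: "\<And>s. 0 \<le> s \<Longrightarrow> s < \<rho>\<^sup>2 \<Longrightarrow>
      radial_laplacian (real DIM('a)) s (P1 s) (P2 s) \<ge> \<mu> * P s"
    and bdry: "\<sigma> \<noteq> \<infinity> \<Longrightarrow> \<rho> * (1 - \<rho>\<^sup>2) * P1 (\<rho>\<^sup>2) + real_of_ereal \<sigma> * P (\<rho>\<^sup>2) > 0"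
  shows "\<mu> \<le> lam"
proof (rule ccontr)
  assume "\<not> \<mu> \<le> lam"
  then have lam: "lam < \<mu>"
    by simp
  have \<rho>01: "0 < \<rho>" "\<rho> < 1"
    using tanh_half_bounds[OF R] by (auto simp: \<rho>)
  show False
  proof (rule robin_eigenfunctionE[OF u \<rho>])
    fix S :: "'a set" and Du D2
    assume S: "open S" "cball 0 \<rho> \<subseteq> S"
      and du: "\<And>x. x \<in> S \<Longrightarrow> (u has_derivative Du x) (at x)"
      and d2u: "\<And>x b. x \<in> ball 0 \<rho> \<Longrightarrow> b \<in> Basis \<Longrightarrow> ((\<lambda>y. Du y b) has_derivative D2 x b) (at x)"
      and eq: "\<And>x. x \<in> ball 0 \<rho> \<Longrightarrow> hyp_laplacian Du D2 x = lam * u x"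
      and bc: "\<And>x. \<sigma> = \<infinity> \<Longrightarrow> x \<in> sphere 0 \<rho> \<Longrightarrow> u x = 0"
        "\<And>x. \<sigma> \<noteq> \<infinity> \<Longrightarrow> x \<in> sphere 0 \<rho> \<Longrightarrow>
           - Du x x / (\<rho> * pc_factor x) = real_of_ereal \<sigma> * u x"
    obtain x where x: "x \<in> sphere 0 \<rho>" "u x > 0" "2 * \<rho>\<^sup>2 * P1 (\<rho>\<^sup>2) * u x \<le> Du x x * P (\<rho>\<^sup>2)"
      by (rule maximum_principle[OF \<rho>01 S du d2u eq pos dP dP1 Ppos super lam])
    show False
    proof (cases "\<sigma> = \<infinity>")
      case True
      then show False
        using bc(1)[OF True x(1)] x(2) by simp
    next
      case False
      define q where "q = 1 - \<rho>\<^sup>2"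
      have q: "q > 0"
        using \<rho>01 by (simp add: q_def abs_square_less_1)
      have "- Du x x / (\<rho> * pc_factor x) = real_of_ereal \<sigma> * u x"
        by (rule bc(2)[OF False x(1)])
      moreover have "pc_factor x = 2 / q"
        using x(1) by (simp add: pc_factor_def q_def)
      ultimately have "Du x x = - real_of_ereal \<sigma> * u x * (2 * \<rho> / q)"
        using q \<rho>01 by (simp add: field_simps)
      then have "(2 * \<rho> / q) * u x * (- real_of_ereal \<sigma> * P (\<rho>\<^sup>2)) = Du x x * P (\<rho>\<^sup>2)"
        by simp
      moreover have "(2 * \<rho> / q) * u x * (\<rho> * q * P1 (\<rho>\<^sup>2)) = 2 * \<rho>\<^sup>2 * P1 (\<rho>\<^sup>2) * u x"
        using q by (simp add: power2_eq_square)
      ultimately have "(2 * \<rho> / q) * u x * (\<rho> * q * P1 (\<rho>\<^sup>2)) \<le> (2 * \<rho> / q) * u x * (- real_of_ereal \<sigma> * P (\<rho>\<^sup>2))"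
        using x(3) by simp
      moreover have "(2 * \<rho> / q) * u x > 0"
        using q \<rho>01 x(2) by simp
      ultimately have "\<rho> * q * P1 (\<rho>\<^sup>2) \<le> - real_of_ereal \<sigma> * P (\<rho>\<^sup>2)"
        by (simp only: mult_le_cancel_left_pos)
      then show False
        using bdry[OF False] by (simp add: q_def)
    qed
  qed
qed

lemma robin_eigenfunction_uminus:
  fixes u :: "'a::euclidean_space \<Rightarrow> real"
  assumes "robin_eigenfunction R \<sigma> lam u"
  shows "robin_eigenfunction R \<sigma> lam (\<lambda>x. - u x)"
proof -
  define \<rho> where "\<rho> = tanh (R / 2)"
  show ?thesis
  proof (rule robin_eigenfunctionE[OF assms \<rho>_def])
    fix S :: "'a set" and Du D2
    assume S: "open S" "cball 0 \<rho> \<subseteq> S" "S \<subseteq> ball 0 1"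
      and du: "\<And>x. x \<in> S \<Longrightarrow> (u has_derivative Du x) (at x)"
      and cont: "\<And>b. b \<in> Basis \<Longrightarrow> continuous_on S (\<lambda>x. Du x b)"
      and d2u: "\<And>x b. x \<in> ball 0 \<rho> \<Longrightarrow> b \<in> Basis \<Longrightarrow> ((\<lambda>y. Du y b) has_derivative D2 x b) (at x)"
      and cont2: "\<And>b c. b \<in> Basis \<Longrightarrow> c \<in> Basis \<Longrightarrow> continuous_on (ball 0 \<rho>) (\<lambda>x. D2 x b c)"
      and nz: "\<exists>x\<in>ball 0 \<rho>. u x \<noteq> 0"
      and eq: "\<And>x. x \<in> ball 0 \<rho> \<Longrightarrow> hyp_laplacian Du D2 x = lam * u x"
      and bc: "\<And>x. \<sigma> = \<infinity> \<Longrightarrow> x \<in> sphere 0 \<rho> \<Longrightarrow> u x = 0"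
        "\<And>x. \<sigma> \<noteq> \<infinity> \<Longrightarrow> x \<in> sphere 0 \<rho> \<Longrightarrow>
           - Du x x / (\<rho> * pc_factor x) = real_of_ereal \<sigma> * u x"
    have "hyp_laplacian (\<lambda>x h. - Du x h) (\<lambda>x b h. - D2 x b h) x = lam * - u x" if "x \<in> ball 0 \<rho>" for x
      using eq[OF that] by (simp add: hyp_laplacian_def sum_negf)
    then show ?thesis
      unfolding robin_eigenfunction_def Let_def geo_ball_radius_def \<rho>_def[symmetric]
      using S nz bc
      by (intro exI[of _ S] exI[of _ "\<lambda>x h. - Du x h"] exI[of _ "\<lambda>x b h. - D2 x b h"])
         (auto intro!: du d2u cont cont2 has_derivative_minus continuous_on_minus simp: minus_equation_iff)
  qed
qed

text \<open>An eigenfunction is nonzero somewhere and the problem is linear, so \<open>u\<close> or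
  \<open>- u\<close> is positive somewhere. The bound thus concerns every eigenvalue, as an infimum
  requires.\<close>

lemma robin_eigenvalue_ge:
  fixes u :: "'a::euclidean_space \<Rightarrow> real"
  assumes R: "R > 0" and \<rho>: "\<rho> = tanh (R / 2)"
    and u: "robin_eigenfunction R \<sigma> lam u"
    and dP: "\<And>s. 0 \<le> s \<Longrightarrow> s < 1 \<Longrightarrow> (P has_real_derivative P1 s) (at s)"
    and dP1: "\<And>s. 0 \<le> s \<Longrightarrow> s < 1 \<Longrightarrow> (P1 has_real_derivative P2 s) (at s)"
    and Ppos: "\<And>s. 0 \<le> s \<Longrightarrow> s \<le> \<rho>\<^sup>2 \<Longrightarrow> P s > 0"
    and super: "\<And>s. 0 \<le> s \<Longrightarrow> s < \<rho>\<^sup>2 \<Longrightarrow>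
      radial_laplacian (real DIM('a)) s (P1 s) (P2 s) \<ge> \<mu> * P s"
    and bdry: "\<sigma> \<noteq> \<infinity> \<Longrightarrow> \<rho> * (1 - \<rho>\<^sup>2) * P1 (\<rho>\<^sup>2) + real_of_ereal \<sigma> * P (\<rho>\<^sup>2) > 0"
  shows "\<mu> \<le> lam"
proof -
  obtain x where x: "x \<in> ball 0 \<rho>" "u x \<noteq> 0"
    using u unfolding robin_eigenfunction_def geo_ball_radius_def Let_def \<rho> by blast
  then consider "u x > 0" | "- u x > 0"
    by linarith
  then show ?thesis
  proof cases
    case 1
    show ?thesis
      by (rule robin_eigenvalue_ge_of_positive_eigenfunction[OF R \<rho> u x(1) 1 dP dP1 Ppos super bdry])
  next
    case 2
    show ?thesis
      by (rule robin_eigenvalue_ge_of_positive_eigenfunction[OF R \<rho>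
            robin_eigenfunction_uminus[OF u] x(1) 2 dP dP1 Ppos super bdry])
  qed
qed

section \<open>An exponential barrier: the spectrum is bounded below\<close>

lemma radial_laplacian_exp_ge:
  assumes s: "0 \<le> s" "s \<le> 1" and n: "n \<ge> 2" and k: "k \<ge> 0"
  shows "- (k\<^sup>2 + 2 * n * k) * exp (k * s)
    \<le> radial_laplacian n s (k * exp (k * s)) (k\<^sup>2 * exp (k * s))"
proof -
  \<comment> \<open>Each coefficient is replaced by a crude bound on the unit interval: this barrier
    only has to give some finite constant.\<close>
  have s1: "s * (1 - s)\<^sup>2 \<le> 1" "s * (1 - s) \<le> 1" "(1 - s)\<^sup>2 \<le> 1"
    using s by (auto intro!: mult_le_one simp: power_le_one)
  have a: "s * (1 - s)\<^sup>2 * k\<^sup>2 \<le> 1 * k\<^sup>2"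
    using s1 by (intro mult_right_mono) auto
  have "n / 2 * (1 - s)\<^sup>2 \<le> n / 2 * 1"
    using s1 n by (intro mult_left_mono) auto
  moreover have "(n - 2) * (s * (1 - s)) \<le> (n - 2) * 1"
    using s1(2) n by (intro mult_left_mono) auto
  ultimately have "n / 2 * (1 - s)\<^sup>2 + (n - 2) * (s * (1 - s)) \<le> n / 2 * 1 + (n - 2) * 1"
    by (rule add_mono)
  then have "n / 2 * (1 - s)\<^sup>2 + (n - 2) * s * (1 - s) \<le> 2 * n"
    using n by (simp add: mult.assoc)
  then have "(n / 2 * (1 - s)\<^sup>2 + (n - 2) * s * (1 - s)) * k \<le> 2 * n * k"
    using k by (rule mult_right_mono)
  with a have "- (k\<^sup>2 + 2 * n * k) \<le>
      - (s * (1 - s)\<^sup>2 * k\<^sup>2 + (n / 2 * (1 - s)\<^sup>2 + (n - 2) * s * (1 - s)) * k)"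
    by simp
  then have "- (k\<^sup>2 + 2 * n * k) * exp (k * s) \<le>
      - (s * (1 - s)\<^sup>2 * k\<^sup>2 + (n / 2 * (1 - s)\<^sup>2 + (n - 2) * s * (1 - s)) * k) * exp (k * s)"
    by (rule mult_right_mono) simp
  then show ?thesis
    by (simp add: radial_laplacian_def algebra_simps)
qed

text \<open>\<open>k\<close> is chosen so that
  \<open>\<rho> * (1 - \<rho>\<^sup>2) * k = \<bar>\<sigma>\<bar> + 1\<close>, which exceeds
  \<open>- \<sigma>\<close>. The exponential barrier therefore works for every real
  \<open>\<sigma>\<close>, however negative.\<close>

lemma exp_boundary_pos:
  fixes \<rho> \<sigma> :: real
  assumes "0 < \<rho>" "\<rho> < 1" and "k = (\<bar>\<sigma>\<bar> + 1) / (\<rho> * (1 - \<rho>\<^sup>2))"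
  shows "k > 0" "\<rho> * (1 - \<rho>\<^sup>2) * (k * exp (k * \<rho>\<^sup>2)) + \<sigma> * exp (k * \<rho>\<^sup>2) > 0"
proof -
  have q: "1 - \<rho>\<^sup>2 > 0"
    using assms by (simp add: abs_square_less_1)
  show "k > 0"
    using q assms by simp
  have "\<rho> * (1 - \<rho>\<^sup>2) * k = \<bar>\<sigma>\<bar> + 1"
    using q assms by simp
  moreover have "\<rho> * (1 - \<rho>\<^sup>2) * (k * exp (k * \<rho>\<^sup>2)) + \<sigma> * exp (k * \<rho>\<^sup>2)
      = (\<rho> * (1 - \<rho>\<^sup>2) * k + \<sigma>) * exp (k * \<rho>\<^sup>2)"
    by (simp add: algebra_simps)
  ultimately show "\<rho> * (1 - \<rho>\<^sup>2) * (k * exp (k * \<rho>\<^sup>2)) + \<sigma> * exp (k * \<rho>\<^sup>2) > 0"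
    by (simp add: zero_less_mult_iff abs_if)
qed

text \<open>This justifies bounding \<open>lambda1\<close> above by a single eigenvalue. For
  \<open>\<sigma> = \<infinity>\<close> the default \<open>real_of_ereal \<sigma> = 0\<close> still
  gives a positive \<open>k\<close>, and no boundary inequality is then demanded.\<close>

lemma robin_spectrum_bdd_below:
  assumes R: "R > 0" and n: "DIM('a::euclidean_space) \<ge> 2"
  shows "bdd_below {lam. \<exists>u::'a \<Rightarrow> real. robin_eigenfunction R \<sigma> lam u}"
proof -
  define \<rho> where "\<rho> = tanh (R / 2)"
  have \<rho>01: "0 < \<rho>" "\<rho> < 1"
    using tanh_half_bounds[OF R] by (auto simp: \<rho>_def)
  define k where "k = (\<bar>real_of_ereal \<sigma>\<bar> + 1) / (\<rho> * (1 - \<rho>\<^sup>2))"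
  note k = exp_boundary_pos[OF \<rho>01 k_def]
  have "- (k\<^sup>2 + 2 * real DIM('a) * k) \<le> lam" if "robin_eigenfunction R \<sigma> lam u" for lam and u :: "'a \<Rightarrow> real"
  proof (rule robin_eigenvalue_ge[OF R \<rho>_def that])
    show "((\<lambda>s. exp (k * s)) has_real_derivative k * exp (k * s)) (at s)" for s
      by (auto intro!: derivative_eq_intros)
    show "((\<lambda>s. k * exp (k * s)) has_real_derivative k\<^sup>2 * exp (k * s)) (at s)" for s
      by (auto intro!: derivative_eq_intros simp: power2_eq_square)
    show "- (k\<^sup>2 + 2 * real DIM('a) * k) * exp (k * s)
      \<le> radial_laplacian (real DIM('a)) s (k * exp (k * s)) (k\<^sup>2 * exp (k * s))"
      if "0 \<le> s" "s < \<rho>\<^sup>2" for s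
    proof (rule radial_laplacian_exp_ge)
      have "\<rho>\<^sup>2 < 1"
        using \<rho>01 by (simp add: abs_square_less_1)
      then show "s \<le> 1"
        using that by linarith
    qed (use that n k in auto)
  qed (use k in auto)
  then show ?thesis
    by (intro bdd_belowI[where m="- (k\<^sup>2 + 2 * real DIM('a) * k)"]) blast
qed

section \<open>The sine barrier and the lower bound\<close>

lemma x_cos_less_sin:
  fixes x :: real
  assumes "0 < x" "x < pi"
  shows "x * cos x < sin x"
proof -
  have "sin 0 - 0 * cos 0 < sin x - x * cos x"
  proof (rule DERIV_pos_imp_increasing_open[OF assms(1)])
    show "\<exists>y. ((\<lambda>x. sin x - x * cos x) has_real_derivative y) (at t) \<and> 0 < y" if "0 < t" "t < x" for t
      using that assms
      by (intro exI[of _ "t * sin t"]) (auto intro!: derivative_eq_intros mult_pos_pos sin_gt_zero)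
    show "continuous_on {0..x} (\<lambda>x. sin x - x * cos x)"
      by (intro continuous_intros)
  qed
  then show ?thesis
    by simp
qed

lemma sin_barrier_derivs:
  fixes m k b s :: real
  assumes "s < 1"
  defines "q \<equiv> \<lambda>s. k * (b - ln (1 - s))"
  shows "((\<lambda>s. (1 - s) powr (m / 2) * sin (q s)) has_real_derivative
      (1 - s) powr (m / 2 - 1) * (k * cos (q s) - m / 2 * sin (q s))) (at s)"
    and "((\<lambda>s. (1 - s) powr (m / 2 - 1) * (k * cos (q s) - m / 2 * sin (q s))) has_real_derivative
      (1 - s) powr (m / 2 - 2) * ((m / 2 * (m / 2 - 1) - k\<^sup>2) * sin (q s) + (1 - m) * k * cos (q s))) (at s)"
proof -
  have dp: "((\<lambda>s. (1 - s) powr a) has_real_derivative - a * (1 - s) powr (a - 1)) (at s)" for a :: real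
    using assms(1) by (auto intro!: derivative_eq_intros)
  have dq: "(q has_real_derivative k / (1 - s)) (at s)"
    unfolding q_def using assms(1) by (auto intro!: derivative_eq_intros)
  have e: "(1 - s) powr a / (1 - s) = (1 - s) powr (a - 1)" for a
    using assms(1) by (simp add: powr_diff)
  show "((\<lambda>s. (1 - s) powr (m / 2) * sin (q s)) has_real_derivative
      (1 - s) powr (m / 2 - 1) * (k * cos (q s) - m / 2 * sin (q s))) (at s)"
    by (rule dp dq refl derivative_eq_intros)+ (simp add: e[symmetric] algebra_simps)
  have "((\<lambda>s. (1 - s) powr (m / 2 - 1) * (k * cos (q s) - m / 2 * sin (q s))) has_real_derivative
      (- (m / 2 - 1) * (1 - s) powr (m / 2 - 1 - 1)) * (k * cos (q s) - m / 2 * sin (q s))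
       + (- k * (k * sin (q s)) - m / 2 * (k * cos (q s))) * ((1 - s) powr (m / 2 - 1) / (1 - s))) (at s)"
    by (rule dp dq refl derivative_eq_intros)+ (simp add: algebra_simps diff_divide_distrib)
  then show "((\<lambda>s. (1 - s) powr (m / 2 - 1) * (k * cos (q s) - m / 2 * sin (q s))) has_real_derivative
      (1 - s) powr (m / 2 - 2) * ((m / 2 * (m / 2 - 1) - k\<^sup>2) * sin (q s) + (1 - m) * k * cos (q s))) (at s)"
    unfolding e by (rule DERIV_cong) (simp add: field_simps power2_eq_square)
qed

text \<open>\<open>S\<close> and \<open>C\<close> stand for the sine and cosine of the phase. The
  leading part is exactly \<open>m\<^sup>2 / 4 + k\<^sup>2\<close> times the barrier, and the
  remainder only has to have the right sign: the supersolution property reduces to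
  \<open>(m + 1) / 2 * (k * C) \<le> (m / 4 - k\<^sup>2) * S\<close>.\<close>

lemma radial_laplacian_sin_barrier:
  fixes m k s S C :: real
  assumes "s < 1"
  shows "radial_laplacian (m + 1) s ((1 - s) powr (m / 2 - 1) * (k * C - m / 2 * S))
      ((1 - s) powr (m / 2 - 2) * ((m / 2 * (m / 2 - 1) - k\<^sup>2) * S + (1 - m) * k * C))
    = (1 - s) powr (m / 2) * ((m\<^sup>2 / 4 + k\<^sup>2) * S + (1 - s) * ((m / 4 - k\<^sup>2) * S - (m + 1) / 2 * (k * C)))"
proof -
  define A where "A = (1 - s) powr (m / 2 - 2)"
  have "(1 - s) powr (m / 2 - 2 + 1) = A * (1 - s)" "(1 - s) powr (m / 2 - 2 + 2) = A * (1 - s)\<^sup>2"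
    using assms by (simp_all only: A_def powr_add) auto
  then have e: "(1 - s) powr (m / 2 - 1) = A * (1 - s)" "(1 - s) powr (m / 2) = A * (1 - s)\<^sup>2"
    by simp_all
  show ?thesis
    unfolding radial_laplacian_def e A_def[symmetric]
    by (simp add: field_simps power2_eq_square)
qed

text \<open>The left side is \<open>2 * ln (cosh (R / 2))\<close>, and
  \<open>cosh x \<le> exp x\<close> for nonnegative \<open>x\<close>. Hence the phase of the barrier
  grows by at most \<open>k * R\<close> from the center to the boundary.\<close>

lemma one_minus_tanh_half_sq:
  fixes R :: real
  assumes "R \<ge> 0"
  shows "- ln (1 - (tanh (R / 2))\<^sup>2) \<le> R"
proof -
  have c: "cosh (R / 2) > 0"
    by simp
  have "cosh (R / 2) \<le> exp (R / 2)"
    using assms by (simp add: cosh_def)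
  then have "ln (cosh (R / 2)) \<le> R / 2"
    using c by (metis ln_exp ln_mono)
  moreover have "1 - (tanh (R / 2))\<^sup>2 = inverse ((cosh (R / 2))\<^sup>2)"
    using c hyperbolic_pythagoras[of "R / 2"]
    by (simp add: tanh_def power_divide inverse_eq_divide diff_divide_eq_iff eq_divide_eq)
  then have "- ln (1 - (tanh (R / 2))\<^sup>2) = 2 * ln (cosh (R / 2))"
    using c by (simp add: ln_inverse ln_realpow)
  ultimately show ?thesis
    by linarith
qed

text \<open>The two phase shifts have separate tasks, both through \<open>x * cos x < sin x\<close>.
  A phase of at least \<open>8 * k\<close> gives \<open>k * cos q \<le> sin q / 8\<close>, which
  controls the remainder in the Laplacian. A phase of at most \<open>pi - k * a\<close> gives
  \<open>k * cos q > - sin q / a\<close>, which yields the boundary inequality once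
  \<open>\<sigma>\<close> is at least \<open>m / 2 + 1 / a\<close>.\<close>

lemma robin_eigenvalue_ge_barrier:
  fixes u :: "'a::euclidean_space \<Rightarrow> real"
  assumes R: "R \<ge> 10" and n: "DIM('a) \<ge> 2" and m: "m = real DIM('a) - 1" and a: "a > 0"
    and \<sigma>: "\<sigma> = \<infinity> \<or> real_of_ereal \<sigma> \<ge> m / 2 + 1 / a"
    and u: "robin_eigenfunction R \<sigma> lam u"
  shows "m\<^sup>2 / 4 + (pi / (R + a + 8))\<^sup>2 \<le> lam"
proof -
  define k where "k = pi / (R + a + 8)"
  define \<rho> where "\<rho> = tanh (R / 2)"
  have R0: "R > 0"
    using R by simp
  have \<rho>01: "0 < \<rho>" "\<rho> < 1"
    using tanh_half_bounds[OF R0] by (auto simp: \<rho>_def)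
  have \<rho>2: "\<rho>\<^sup>2 < 1"
    using \<rho>01 by (simp add: abs_square_less_1)
  have m1: "m \<ge> 1"
    using n by (simp add: m)
  have k: "k > 0"
    using R a by (simp add: k_def)
  \<comment> \<open>The target is \<open>k\<^sup>2 \<le> 1 / 8\<close>, which for
    \<open>m \<ge> 1\<close> ensures \<open>(m + 1) / 16 \<le> m / 4 - k\<^sup>2\<close>; the case
    \<open>m = 1\<close> is the tight one.\<close>
  have "pi / (R + a + 8) \<le> 32 / 10 / 10"
    using R a pi_less_4 pi_approx by (intro frac_le) auto
  then have "k\<^sup>2 \<le> (32 / 10 / 10)\<^sup>2"
    using k unfolding k_def by (intro power_mono) auto
  then have k2: "k\<^sup>2 \<le> 1 / 8"
    by (simp add: power2_eq_square)
  define q where "q = (\<lambda>s::real. k * (8 - ln (1 - s)))"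
  have q: "k * 8 \<le> q s" "q s \<le> pi - k * a" "0 < q s" "q s < pi" if s: "0 \<le> s" "s \<le> \<rho>\<^sup>2" for s
  proof -
    have "ln (1 - s) \<le> 0"
      using s \<rho>2 by simp
    then show l: "k * 8 \<le> q s"
      unfolding q_def using k by (intro mult_left_mono) auto
    have "ln (1 - \<rho>\<^sup>2) \<le> ln (1 - s)"
      using s \<rho>2 by (intro ln_mono) auto
    then have "8 - ln (1 - s) \<le> R + 8"
      using one_minus_tanh_half_sq[of R] R0 by (simp add: \<rho>_def)
    then have "q s \<le> k * (R + 8)"
      unfolding q_def using k by (intro mult_left_mono) auto
    also have "k * (R + 8) = pi - k * a"
      using R a by (simp add: k_def field_simps)
    finally show "q s \<le> pi - k * a" .
    then show "q s < pi"
      using k a by (smt (verit) mult_pos_pos)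
    show "0 < q s"
      using l k by linarith
  qed
  have sinpos: "sin (q s) > 0" if "0 \<le> s" "s \<le> \<rho>\<^sup>2" for s
    using q[OF that] by (intro sin_gt_zero)
  have cos_le: "k * cos (q s) \<le> sin (q s) / 8" if s: "0 \<le> s" "s \<le> \<rho>\<^sup>2" for s
  proof (cases "cos (q s) \<ge> 0")
    case True
    then have "k * 8 * cos (q s) \<le> q s * cos (q s)"
      using q(1)[OF s] by (intro mult_right_mono)
    also have "\<dots> \<le> sin (q s)"
      using x_cos_less_sin q[OF s] by (simp add: less_imp_le)
    finally show ?thesis
      by simp
  next
    case False
    then have "k * cos (q s) \<le> 0"
      using k by (simp add: mult_nonneg_nonpos)
    then show ?thesis
      using sinpos[OF s] by simp
  qed
  have cos_ge: "- sin (q s) / a < k * cos (q s)" if s: "0 \<le> s" "s \<le> \<rho>\<^sup>2" for s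
  proof (cases "cos (q s) \<ge> 0")
    case True
    have "- sin (q s) / a < 0"
      using sinpos[OF s] a by simp
    also have "0 \<le> k * cos (q s)"
      using True k by simp
    finally show ?thesis .
  next
    case False
    \<comment> \<open>Reflection at \<open>pi\<close>: \<open>t\<close> is the phase still missing
      to \<open>pi\<close>, at least \<open>k * a\<close>, and its cosine is positive here.\<close>
    define t where "t = pi - q s"
    have t: "0 < t" "t < pi" "k * a \<le> t"
      using q[OF s] by (auto simp: t_def)
    have ct: "cos (q s) = - cos t" "sin (q s) = sin t"
      by (simp_all add: t_def)
    have "k * a * cos t \<le> t * cos t"
      using False t(3) ct by (intro mult_right_mono) auto
    also have "\<dots> < sin t"
      using x_cos_less_sin t by simp
    finally show ?thesis
      using a by (simp add: ct field_simps)
  qed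
  have "m\<^sup>2 / 4 + k\<^sup>2 \<le> lam"
  proof (rule robin_eigenvalue_ge[OF R0 \<rho>_def u])
    show "((\<lambda>s. (1 - s) powr (m / 2) * sin (q s)) has_real_derivative
      (1 - s) powr (m / 2 - 1) * (k * cos (q s) - m / 2 * sin (q s))) (at s)" if "s < 1" for s
      unfolding q_def by (rule sin_barrier_derivs(1)[OF that])
    show "((\<lambda>s. (1 - s) powr (m / 2 - 1) * (k * cos (q s) - m / 2 * sin (q s))) has_real_derivative
      (1 - s) powr (m / 2 - 2) * ((m / 2 * (m / 2 - 1) - k\<^sup>2) * sin (q s) + (1 - m) * k * cos (q s))) (at s)"
      if "s < 1" for s
      unfolding q_def by (rule sin_barrier_derivs(2)[OF that])
    show "(1 - s) powr (m / 2) * sin (q s) > 0" if "0 \<le> s" "s \<le> \<rho>\<^sup>2" for s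
      using sinpos[OF that] that \<rho>2 by simp
    show "(m\<^sup>2 / 4 + k\<^sup>2) * ((1 - s) powr (m / 2) * sin (q s))
      \<le> radial_laplacian (real DIM('a)) s ((1 - s) powr (m / 2 - 1) * (k * cos (q s) - m / 2 * sin (q s)))
         ((1 - s) powr (m / 2 - 2) * ((m / 2 * (m / 2 - 1) - k\<^sup>2) * sin (q s) + (1 - m) * k * cos (q s)))"
      if s: "0 \<le> s" "s < \<rho>\<^sup>2" for s
    proof -
      have s': "0 \<le> s" "s \<le> \<rho>\<^sup>2"
        using s by auto
      have s1: "s < 1"
        using s \<rho>2 by simp
      have "(m + 1) / 2 * (k * cos (q s)) \<le> (m + 1) / 2 * (sin (q s) / 8)"
        using cos_le[OF s'] m1 by (intro mult_left_mono) auto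
      also have "\<dots> = (m + 1) / 16 * sin (q s)"
        by simp
      also have "\<dots> \<le> (m / 4 - k\<^sup>2) * sin (q s)"
        using sinpos[OF s'] m1 k2 by (intro mult_right_mono) auto
      finally have "0 \<le> (1 - s) * ((m / 4 - k\<^sup>2) * sin (q s) - (m + 1) / 2 * (k * cos (q s)))"
        using s1 by simp
      then have "(1 - s) powr (m / 2) * ((m\<^sup>2 / 4 + k\<^sup>2) * sin (q s))
        \<le> (1 - s) powr (m / 2) * ((m\<^sup>2 / 4 + k\<^sup>2) * sin (q s)
            + (1 - s) * ((m / 4 - k\<^sup>2) * sin (q s) - (m + 1) / 2 * (k * cos (q s))))"
        by (intro mult_left_mono) auto
      moreover have "real DIM('a) = m + 1"
        by (simp add: m)
      ultimately show ?thesis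
        using radial_laplacian_sin_barrier[OF s1, of m k "cos (q s)" "sin (q s)"]
        by (simp only: mult.left_commute[of "m\<^sup>2 / 4 + k\<^sup>2"])
    qed
    show "\<rho> * (1 - \<rho>\<^sup>2) * ((1 - \<rho>\<^sup>2) powr (m / 2 - 1) * (k * cos (q (\<rho>\<^sup>2)) - m / 2 * sin (q (\<rho>\<^sup>2))))
      + real_of_ereal \<sigma> * ((1 - \<rho>\<^sup>2) powr (m / 2) * sin (q (\<rho>\<^sup>2))) > 0" if "\<sigma> \<noteq> \<infinity>"
    proof -
      define X where "X = k * cos (q (\<rho>\<^sup>2)) - m / 2 * sin (q (\<rho>\<^sup>2))"
      define Y where "Y = sin (q (\<rho>\<^sup>2))"
      have Y: "Y > 0"
        using sinpos[of "\<rho>\<^sup>2"] by (simp add: Y_def)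
      have "X > - ((m / 2 + 1 / a) * Y)"
        using cos_ge[of "\<rho>\<^sup>2"] by (simp add: X_def Y_def algebra_simps)
      moreover have "(m / 2 + 1 / a) * Y \<le> real_of_ereal \<sigma> * Y"
        using \<sigma> that Y by (intro mult_right_mono) auto
      ultimately have XY: "X + real_of_ereal \<sigma> * Y > 0"
        by linarith
      have \<sigma>Y: "real_of_ereal \<sigma> * Y > 0"
      proof (rule mult_pos_pos)
        have "0 < m / 2 + 1 / a"
          using m1 a by (intro add_pos_pos) auto
        then show "0 < real_of_ereal \<sigma>"
          using \<sigma> that by auto
      qed (rule Y)
      \<comment> \<open>For negative \<open>X\<close> the factor \<open>\<rho> < 1\<close> only
        helps; for nonnegative \<open>X\<close> the positivity of \<open>\<sigma>\<close>
        suffices.\<close>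
      have "\<rho> * X + real_of_ereal \<sigma> * Y > 0"
      proof (cases "X \<ge> 0")
        case True
        then have "\<rho> * X \<ge> 0"
          using \<rho>01 by simp
        then show ?thesis
          using \<sigma>Y by linarith
      next
        case False
        then have "\<rho> * X \<ge> 1 * X"
          using \<rho>01 by (intro mult_right_mono_neg) auto
        then show ?thesis
          using XY by linarith
      qed
      then have "(1 - \<rho>\<^sup>2) powr (m / 2) * (\<rho> * X + real_of_ereal \<sigma> * Y) > 0"
        using \<rho>2 by simp
      moreover have e: "(1 - \<rho>\<^sup>2) powr (m / 2) = (1 - \<rho>\<^sup>2) * (1 - \<rho>\<^sup>2) powr (m / 2 - 1)"
        using \<rho>2 by (simp add: powr_diff)
      ultimately show ?thesis
        unfolding X_def[symmetric] unfolding Y_def[symmetric] e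
        by (simp only: distrib_left distrib_right mult_ac)
    qed
  qed
  then show ?thesis
    by (simp add: k_def)
qed

text \<open>In the expansion of \<open>(R - 2 * d) * (R + d)\<^sup>2\<close> the terms in
  \<open>R\<^sup>2\<close> cancel and all others except \<open>R ^ 3\<close> are negative. With
  \<open>d = a + 8\<close> this produces the constant \<open>2 * pi\<^sup>2 * (a + 8)\<close> of the
  lower bound.\<close>

lemma inverse_square_shift_ge:
  fixes R d :: real
  assumes "R > 0" "d > 0"
  shows "1 / R\<^sup>2 - 2 * d / R ^ 3 \<le> 1 / (R + d)\<^sup>2"
proof -
  have "(R - 2 * d) * (R + d)\<^sup>2 = R ^ 3 - (3 * R * d\<^sup>2 + 2 * d ^ 3)"
    by (simp add: algebra_simps power2_eq_square power3_eq_cube)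
  also have "\<dots> \<le> R ^ 3"
    using assms by (smt (verit) mult_pos_pos zero_less_power)
  finally have "(R - 2 * d) / R ^ 3 \<le> 1 / (R + d)\<^sup>2"
    using assms by (simp add: divide_le_eq pos_le_divide_eq mult.commute)
  moreover have "(R - 2 * d) / R ^ 3 = 1 / R\<^sup>2 - 2 * d / R ^ 3"
    using assms by (simp add: field_simps power2_eq_square power3_eq_cube)
  ultimately show ?thesis
    by simp
qed

section \<open>The radial solution as a power series\<close>

text \<open>The recurrence compares coefficients in
  \<open>s (1 - s)^2 P'' + (n/2 - 2 s + (2 - n/2) s^2) P' + l P = 0\<close>. The exponents at the
  origin are 0 and \<open>1 - n/2\<close>; the series belongs to the exponent 0, normalized to the
  value 1. Every coefficient is a polynomial in \<open>l\<close>.\<close>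

fun radial_coeff :: "real \<Rightarrow> real \<Rightarrow> nat \<Rightarrow> real" where
  "radial_coeff n l 0 = 1"
| "radial_coeff n l (Suc 0) = - 2 * l / n"
| "radial_coeff n l (Suc (Suc k)) =
     ((2 * (real k + 1)\<^sup>2 - l) * radial_coeff n l (Suc k)
       - real k * (real k + 1 - n / 2) * radial_coeff n l k) / ((real k + 2) * (real k + 1 + n / 2))"

text \<open>The product grows only like \<open>k powr L\<close>, which keeps the radius of
  convergence at 1. It involves \<open>l\<close> only through a bound \<open>L\<close>, so estimates
  by it are uniform for \<open>l\<close> in a compact interval.\<close>

primrec coeff_growth :: "real \<Rightarrow> nat \<Rightarrow> real" where
  "coeff_growth L 0 = 1 + L"
| "coeff_growth L (Suc k) = coeff_growth L k * (1 + L / (real k + 2))"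

text \<open>The characteristic equation of the recurrence has the double root \<open>1\<close>, so a crude bound would
  not give radius of convergence \<open>1\<close>. The differences of consecutive coefficients satisfy a
  recurrence whose leading factor has modulus at most \<open>1\<close>.\<close>

lemma radial_coeff_diff:
  assumes "n \<ge> 2"
  shows "radial_coeff n l (Suc (Suc k)) - radial_coeff n l (Suc k) =
    (real k * (real k + 1 - n / 2) * (radial_coeff n l (Suc k) - radial_coeff n l k)
      - (l + n) * radial_coeff n l (Suc k)) / ((real k + 2) * (real k + 1 + n / 2))"
proof -
  define D where "D = (real k + 2) * (real k + 1 + n / 2)"
  have D: "D > 0"
    using assms by (simp add: D_def)
  define a b where "a = radial_coeff n l (Suc k)" and "b = radial_coeff n l k"
  have "((2 * (real k + 1)\<^sup>2 - l) * a - real k * (real k + 1 - n / 2) * b) - D * a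
    = real k * (real k + 1 - n / 2) * (a - b) - (l + n) * a"
    unfolding D_def by (simp add: field_simps power2_eq_square)
  then have "((2 * (real k + 1)\<^sup>2 - l) * a - real k * (real k + 1 - n / 2) * b) / D - a
    = (real k * (real k + 1 - n / 2) * (a - b) - (l + n) * a) / D"
    using D by (simp add: field_simps)
  then show ?thesis
    by (simp only: radial_coeff.simps D_def a_def b_def)
qed

lemma coeff_growth_pos: "L \<ge> 0 \<Longrightarrow> coeff_growth L k > 0"
  by (induction k) (auto intro!: mult_pos_pos add_pos_nonneg)

text \<open>The two estimates feed each other: adding a difference to a coefficient accounts for the
  factor \<open>real k + 1\<close>, while the term \<open>(l + n) * radial_coeff n l (Suc k)\<close>
  in the recurrence for the differences costs the factor
  \<open>1 + L / (real k + 2)\<close>.\<close>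

lemma radial_coeff_bound:
  assumes n: "n \<ge> 2" and l: "\<bar>l\<bar> + n \<le> L"
  shows "\<bar>radial_coeff n l k\<bar> \<le> (real k + 1) * coeff_growth L k"
    and "\<bar>radial_coeff n l (Suc k) - radial_coeff n l k\<bar> \<le> coeff_growth L k"
proof -
  have L: "L \<ge> 0"
    using n l by linarith
  have "\<bar>radial_coeff n l k\<bar> \<le> (real k + 1) * coeff_growth L k \<and>
    \<bar>radial_coeff n l (Suc k) - radial_coeff n l k\<bar> \<le> coeff_growth L k" (is "?P k")
  proof (induction k)
    case 0
    have "\<bar>2 * l / n\<bar> = \<bar>l\<bar> * (2 / n)"
      using n by (simp add: abs_mult)
    also have "\<dots> \<le> \<bar>l\<bar> * 1"
      using n by (intro mult_left_mono) auto
    finally have "\<bar>2 * l / n\<bar> \<le> L"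
      using l n by linarith
    then have "\<bar>- (2 * l / n) - 1\<bar> \<le> 1 + L"
      by linarith
    then show ?case
      using L by simp
  next
    case (Suc k)
    define B where "B = coeff_growth L k"
    define a b where "a = radial_coeff n l (Suc k)" and "b = radial_coeff n l k"
    define D where "D = (real k + 2) * (real k + 1 + n / 2)"
    have B: "B > 0"
      using coeff_growth_pos[OF L] by (simp add: B_def)
    have IH: "\<bar>b\<bar> \<le> (real k + 1) * B" "\<bar>a - b\<bar> \<le> B"
      using Suc.IH by (auto simp: a_def b_def B_def)
    have a: "\<bar>a\<bar> \<le> (real k + 2) * B"
      using IH by (simp add: algebra_simps)
    have D: "D > 0"
      using n by (simp add: D_def)
    have "\<bar>real k * (real k + 1 - n / 2) * (a - b)\<bar> \<le> D * B"
    proof -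
      have "\<bar>real k * (real k + 1 - n / 2)\<bar> \<le> D"
        unfolding D_def abs_mult using n by (intro mult_mono) auto
      then show ?thesis
        unfolding abs_mult[of _ "a - b"] using IH(2) by (intro mult_mono) auto
    qed
    moreover have "\<bar>(l + n) * a\<bar> \<le> L * ((real k + 2) * B)"
      unfolding abs_mult using a n l by (intro mult_mono) auto
    ultimately have "\<bar>real k * (real k + 1 - n / 2) * (a - b) - (l + n) * a\<bar> \<le> D * B + L * ((real k + 2) * B)"
      by linarith
    then have "\<bar>(real k * (real k + 1 - n / 2) * (a - b) - (l + n) * a) / D\<bar>
        \<le> (D * B + L * ((real k + 2) * B)) / D"
      unfolding abs_divide using D by (simp add: divide_right_mono)
    also have "\<dots> = B + B * (L / (real k + 1 + n / 2))"
    proof -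
      have "real k + 1 + n / 2 > 0" "real k + 2 > 0"
        using n by auto
      then show ?thesis
        by (simp add: D_def add_divide_distrib)
    qed
    also have "\<dots> \<le> B + B * (L / (real k + 2))"
      using n L B by (intro add_left_mono mult_left_mono divide_left_mono) auto
    also have "\<dots> = coeff_growth L (Suc k)"
      by (simp add: B_def algebra_simps)
    finally have d: "\<bar>radial_coeff n l (Suc (Suc k)) - a\<bar> \<le> coeff_growth L (Suc k)"
      unfolding a_def radial_coeff_diff[OF n] D_def b_def .
    have "B * 1 \<le> B * (1 + L / (real k + 2))"
      using B L by (intro mult_left_mono) auto
    then have "B \<le> coeff_growth L (Suc k)"
      by (simp add: B_def)
    then have "(real k + 2) * B \<le> (real k + 2) * coeff_growth L (Suc k)"
      by (intro mult_left_mono) auto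
    with a have "\<bar>a\<bar> \<le> (real k + 2) * coeff_growth L (Suc k)"
      by linarith
    moreover have "real (Suc k) + 1 = real k + 2"
      by simp
    ultimately show ?case
      using d unfolding a_def by (simp only:)
  qed
  then show "\<bar>radial_coeff n l k\<bar> \<le> (real k + 1) * coeff_growth L k"
    and "\<bar>radial_coeff n l (Suc k) - radial_coeff n l k\<bar> \<le> coeff_growth L k"
    by auto
qed

lemma summable_coeff_growth:
  fixes x :: real
  assumes L: "L \<ge> 0" and x: "\<bar>x\<bar> < 1"
  shows "summable (\<lambda>k. ((real k + 1) * coeff_growth L k) * x ^ k)"
proof (cases "x = 0")
  case False
  define f where "f = (\<lambda>k. ((real k + 1) * coeff_growth L k) * x ^ k)"
  have "(\<lambda>k. (real k + 2) / (real k + 1) * (1 + L / (real k + 2)) * \<bar>x\<bar>) \<longlonglongrightarrow> 1 * (1 + 0) * \<bar>x\<bar>"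
    by (intro tendsto_intros; real_asymp)
  \<comment> \<open>The ratio of consecutive terms tends to \<open>\<bar>x\<bar>\<close>; the
    midpoint between this limit and 1 serves as the constant of the ratio test.\<close>
  then have "\<forall>\<^sub>F k in sequentially. (real k + 2) / (real k + 1) * (1 + L / (real k + 2)) * \<bar>x\<bar> < (1 + \<bar>x\<bar>) / 2"
    by (rule order_tendstoD) (use x in auto)
  then obtain N where N: "\<And>k. k \<ge> N \<Longrightarrow>
      (real k + 2) / (real k + 1) * (1 + L / (real k + 2)) * \<bar>x\<bar> < (1 + \<bar>x\<bar>) / 2"
    by (auto simp: eventually_sequentially)
  have "summable f"
  proof (rule summable_ratio_test[where c="(1 + \<bar>x\<bar>) / 2" and N=N])
    show "norm (f (Suc k)) \<le> (1 + \<bar>x\<bar>) / 2 * norm (f k)" if "N \<le> k" for k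
    proof -
      have p: "1 + L / (real k + 2) > 0"
        using L by (intro add_pos_nonneg) auto
      have "f (Suc k) = ((real k + 2) / (real k + 1) * (1 + L / (real k + 2)) * x) * f k"
        by (simp add: f_def)
      then have "norm (f (Suc k)) = ((real k + 2) / (real k + 1) * (1 + L / (real k + 2)) * \<bar>x\<bar>) * norm (f k)"
        using p by (simp add: abs_mult)
      also have "\<dots> \<le> (1 + \<bar>x\<bar>) / 2 * norm (f k)"
        using N[OF that] by (intro mult_right_mono) auto
      finally show ?thesis .
    qed
  qed (use x in auto)
  then show ?thesis
    by (simp add: f_def)
qed auto

text \<open>Weierstrass M-test with a majorant independent of the parameter. Joint continuity is
  what later makes the set of pairs \<open>(s, l)\<close> with nonpositive solution closed.\<close>

lemma powser_jointly_continuous: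
  fixes c :: "nat \<Rightarrow> real \<Rightarrow> real"
  assumes cont: "\<And>k. continuous_on J (c k)" and bd: "\<And>k l. l \<in> J \<Longrightarrow> \<bar>c k l\<bar> \<le> M k"
    and sm: "summable (\<lambda>k. M k * t ^ k)"
  shows "continuous_on ({0..t} \<times> J) (\<lambda>p. \<Sum>k. c k (snd p) * fst p ^ k)"
proof (rule uniform_limit_theorem)
  show "uniform_limit ({0..t} \<times> J) (\<lambda>N p. \<Sum>k<N. c k (snd p) * fst p ^ k)
      (\<lambda>p. \<Sum>k. c k (snd p) * fst p ^ k) sequentially"
  proof (rule Weierstrass_m_test[OF _ sm])
    fix k and p :: "real \<times> real"
    assume "p \<in> {0..t} \<times> J"
    then have p: "0 \<le> fst p" "fst p \<le> t" "snd p \<in> J"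
      by auto
    have "0 \<le> M k"
      using bd[OF p(3), of k] by linarith
    then show "norm (c k (snd p) * fst p ^ k) \<le> M k * t ^ k"
      using p bd by (auto simp: abs_mult intro!: mult_mono power_mono)
  qed
  show "\<forall>\<^sub>F N in sequentially. continuous_on ({0..t} \<times> J) (\<lambda>p. \<Sum>k<N. c k (snd p) * fst p ^ k)"
    by (intro always_eventually allI continuous_intros continuous_on_compose2[OF cont]) auto
qed simp

definition radial_sol :: "real \<Rightarrow> real \<Rightarrow> real \<Rightarrow> real" where
  "radial_sol n l s = (\<Sum>k. radial_coeff n l k * s ^ k)"

definition radial_sol1 :: "real \<Rightarrow> real \<Rightarrow> real \<Rightarrow> real" where
  "radial_sol1 n l s = (\<Sum>k. diffs (radial_coeff n l) k * s ^ k)"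

definition radial_sol2 :: "real \<Rightarrow> real \<Rightarrow> real \<Rightarrow> real" where
  "radial_sol2 n l s = (\<Sum>k. diffs (diffs (radial_coeff n l)) k * s ^ k)"

lemma summable_radial_coeff:
  assumes n: "n \<ge> 2" and s: "\<bar>s\<bar> < 1"
  shows "summable (\<lambda>k. radial_coeff n l k * s ^ k)"
proof (rule summable_comparison_test'[where N=0])
  define L where "L = \<bar>l\<bar> + n"
  show "summable (\<lambda>k. ((real k + 1) * coeff_growth L k) * \<bar>s\<bar> ^ k)"
    by (rule summable_coeff_growth) (use n s in \<open>auto simp: L_def\<close>)
  show "norm (radial_coeff n l k * s ^ k) \<le> ((real k + 1) * coeff_growth L k) * \<bar>s\<bar> ^ k" for k
    using radial_coeff_bound(1)[OF n, of l L k] by (auto simp: abs_mult power_abs L_def intro!: mult_right_mono)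
qed

lemma summable_diffs_radial_coeff:
  assumes n: "n \<ge> 2" and s: "\<bar>s\<bar> < 1"
  shows "summable (\<lambda>k. diffs (radial_coeff n l) k * s ^ k)"
  by (rule termdiff_converges[of s 1]) (use s summable_radial_coeff[OF n] in auto)

lemma summable_diffs2_radial_coeff:
  assumes n: "n \<ge> 2" and s: "\<bar>s\<bar> < 1"
  shows "summable (\<lambda>k. diffs (diffs (radial_coeff n l)) k * s ^ k)"
  by (rule termdiff_converges[of s 1]) (use s summable_diffs_radial_coeff[OF n] in auto)

text \<open>The continuity of the second derivative serves the \<open>C^2\<close> requirement on
  classical eigenfunctions.\<close>

lemma radial_sol_derivs:
  assumes n: "n \<ge> 2" and s: "\<bar>s\<bar> < 1"
  shows "(radial_sol n l has_real_derivative radial_sol1 n l s) (at s)"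
    and "(radial_sol1 n l has_real_derivative radial_sol2 n l s) (at s)"
    and "isCont (radial_sol2 n l) s"
proof -
  show "(radial_sol n l has_real_derivative radial_sol1 n l s) (at s)"
    unfolding radial_sol_def[abs_def] radial_sol1_def
    by (rule termdiffs_strong'[where K=1]) (use s summable_radial_coeff[OF n] in auto)
  show "(radial_sol1 n l has_real_derivative radial_sol2 n l s) (at s)"
    unfolding radial_sol1_def[abs_def] radial_sol2_def
    by (rule termdiffs_strong'[where K=1]) (use s summable_diffs_radial_coeff[OF n] in auto)
  have "(radial_sol2 n l has_real_derivative (\<Sum>k. diffs (diffs (diffs (radial_coeff n l))) k * s ^ k)) (at s)"
    unfolding radial_sol2_def[abs_def]
    by (rule termdiffs_strong'[where K=1]) (use s summable_diffs2_radial_coeff[OF n] in auto)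
  then show "isCont (radial_sol2 n l) s"
    by (rule DERIV_isCont)
qed

lemma powser_shift_sums:
  fixes c :: "nat \<Rightarrow> real"
  assumes "(\<lambda>k. c k * s ^ k) sums x"
  shows "(\<lambda>k. (case k of 0 \<Rightarrow> 0 | Suc j \<Rightarrow> c j) * s ^ k) sums (s * x)"
proof -
  have "(\<lambda>k. s * (c k * s ^ k)) sums (s * x)"
    by (rule sums_mult[OF assms])
  then have "(\<lambda>k. (case Suc k of 0 \<Rightarrow> 0 | Suc j \<Rightarrow> c j) * s ^ Suc k) sums (s * x)"
    by (simp add: mult_ac)
  then show ?thesis
    by (subst (asm) sums_Suc_iff) simp
qed

lemma radial_sol_ode:
  assumes n: "n \<ge> 2" and s: "\<bar>s\<bar> < 1"
  shows "radial_laplacian n s (radial_sol1 n l s) (radial_sol2 n l s) = l * radial_sol n l s"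
proof -
  define a where "a = radial_coeff n l"
  define sh where "sh = (\<lambda>(c::nat \<Rightarrow> real) k. case k of 0 \<Rightarrow> 0 | Suc j \<Rightarrow> c j)"
  have sh: "(\<lambda>k. c k * s ^ k) sums x \<Longrightarrow> (\<lambda>k. sh c k * s ^ k) sums (s * x)" for c x
    unfolding sh_def by (rule powser_shift_sums)
  have F: "(\<lambda>k. a k * s ^ k) sums radial_sol n l s"
    unfolding a_def radial_sol_def by (intro summable_sums summable_radial_coeff n s)
  have F1: "(\<lambda>k. diffs a k * s ^ k) sums radial_sol1 n l s"
    unfolding a_def radial_sol1_def by (intro summable_sums summable_diffs_radial_coeff n s)
  have F2: "(\<lambda>k. diffs (diffs a) k * s ^ k) sums radial_sol2 n l s"
    unfolding a_def radial_sol2_def by (intro summable_sums summable_diffs2_radial_coeff n s)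
  define c2 where "c2 = sh (diffs (diffs a))"
  define c1 where "c1 = diffs a"
  \<comment> \<open>Multiplication by \<open>s\<close> is the index shift \<open>sh\<close>, and the
    factor of the first derivative is expanded as \<open>n/2 - 2 s + (2 - n/2) s^2\<close>.\<close>
  have "(\<lambda>k. (c2 k * s ^ k - 2 * (sh c2 k * s ^ k) + sh (sh c2) k * s ^ k)
      + (n / 2 * (c1 k * s ^ k) - 2 * (sh c1 k * s ^ k) + (2 - n / 2) * (sh (sh c1) k * s ^ k)) + l * (a k * s ^ k))
    sums ((s * radial_sol2 n l s - 2 * (s * (s * radial_sol2 n l s)) + s * (s * (s * radial_sol2 n l s)))
      + (n / 2 * radial_sol1 n l s - 2 * (s * radial_sol1 n l s) + (2 - n / 2) * (s * (s * radial_sol1 n l s)))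
      + l * radial_sol n l s)"
    unfolding c2_def c1_def by (intro sums_add sums_diff sums_mult sh F F1 F2)
  moreover have "(c2 k * s ^ k - 2 * (sh c2 k * s ^ k) + sh (sh c2) k * s ^ k)
      + (n / 2 * (c1 k * s ^ k) - 2 * (sh c1 k * s ^ k) + (2 - n / 2) * (sh (sh c1) k * s ^ k)) + l * (a k * s ^ k) = 0" for k
  proof -
    have "(c2 k - 2 * sh c2 k + sh (sh c2) k)
      + (n / 2 * c1 k - 2 * sh c1 k + (2 - n / 2) * sh (sh c1) k) + l * a k = 0"
    \<comment> \<open>The shifted sequences vanish at the lowest indices, so \<open>k = 0\<close>,
      \<open>k = 1\<close> and \<open>k = 2\<close> are separated from the generic index.\<close>
    proof (cases k)
      case 0
      then show ?thesis
        using n by (simp add: c1_def c2_def sh_def diffs_def a_def)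
    next
      case (Suc j)
      have "real j + 2 > 0" "real j + 1 + n / 2 > 0"
        using n by auto
      then have rec: "(real j + 2) * (real j + 1 + n / 2) * a (Suc (Suc j)) =
        (2 * (real j + 1)\<^sup>2 - l) * a (Suc j) - real j * (real j + 1 - n / 2) * a j"
        by (simp add: a_def)
      show ?thesis
      proof (cases j)
        case 0
        then show ?thesis
          using rec Suc by (simp add: c1_def c2_def sh_def diffs_def algebra_simps)
      next
        case (Suc i)
        then show ?thesis
          using rec \<open>k = Suc j\<close>
          by (cases i) (simp_all add: c1_def c2_def sh_def diffs_def algebra_simps power2_eq_square)
      qed
    qed
    then have "((c2 k - 2 * sh c2 k + sh (sh c2) k)
      + (n / 2 * c1 k - 2 * sh c1 k + (2 - n / 2) * sh (sh c1) k) + l * a k) * s ^ k = 0"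
      by simp
    then show ?thesis
      by (simp only: distrib_right left_diff_distrib mult.assoc)
  qed
  ultimately have "(\<lambda>k. 0) sums ((s * radial_sol2 n l s - 2 * (s * (s * radial_sol2 n l s)) + s * (s * (s * radial_sol2 n l s)))
      + (n / 2 * radial_sol1 n l s - 2 * (s * radial_sol1 n l s) + (2 - n / 2) * (s * (s * radial_sol1 n l s)))
      + l * radial_sol n l s)"
    by (simp only:)
  note this[THEN sums_unique2, OF sums_zero]
  then show ?thesis
    unfolding radial_laplacian_def by (simp add: field_simps power2_eq_square)
qed

lemma continuous_on_radial_coeff:
  "continuous_on J (\<lambda>l. radial_coeff n l k)"
proof -
  have "continuous_on J (\<lambda>l. radial_coeff n l k) \<and> continuous_on J (\<lambda>l. radial_coeff n l (Suc k))"
  proof (induction k)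
    case 0
    show ?case
      unfolding radial_coeff.simps divide_inverse by (intro conjI continuous_intros)
  next
    case (Suc k)
    then show ?case
      unfolding radial_coeff.simps divide_inverse by (intro conjI continuous_intros) auto
  qed
  then show ?thesis
    by simp
qed

lemma radial_sol_jointly_continuous:
  assumes n: "n \<ge> 2" and t: "0 \<le> t" "t < 1"
  shows "continuous_on ({0..t} \<times> {l0..l1}) (\<lambda>p. radial_sol n (snd p) (fst p))"
    and "continuous_on ({0..t} \<times> {l0..l1}) (\<lambda>p. radial_sol1 n (snd p) (fst p))"
proof -
  define L where "L = max \<bar>l0\<bar> \<bar>l1\<bar> + n"
  define M where "M = (\<lambda>k. (real k + 1) * coeff_growth L k)"
  have L: "L \<ge> 0"
    using n by (simp add: L_def)
  have bd: "\<bar>radial_coeff n l k\<bar> \<le> M k" if "l \<in> {l0..l1}" for l k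
    unfolding M_def by (rule radial_coeff_bound[OF n]) (use that in \<open>auto simp: L_def\<close>)
  have sm: "summable (\<lambda>k. M k * x ^ k)" if "\<bar>x\<bar> < 1" for x
    unfolding M_def by (rule summable_coeff_growth[OF L that])
  show "continuous_on ({0..t} \<times> {l0..l1}) (\<lambda>p. radial_sol n (snd p) (fst p))"
    unfolding radial_sol_def
    by (rule powser_jointly_continuous[where M=M]) (use t bd sm in \<open>auto intro: continuous_on_radial_coeff\<close>)
  show "continuous_on ({0..t} \<times> {l0..l1}) (\<lambda>p. radial_sol1 n (snd p) (fst p))"
    unfolding radial_sol1_def
  proof (rule powser_jointly_continuous[where M="diffs M"])
    show "continuous_on {l0..l1} (\<lambda>l. diffs (radial_coeff n l) k)" for k
      unfolding diffs_def by (intro continuous_intros continuous_on_radial_coeff)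
    show "\<bar>diffs (radial_coeff n l) k\<bar> \<le> diffs M k" if "l \<in> {l0..l1}" for l k
      using bd[OF that, of "Suc k"] by (simp add: diffs_def abs_mult mult_left_mono)
    show "summable (\<lambda>k. diffs M k * t ^ k)"
      by (rule termdiff_converges[of t 1]) (use t sm in auto)
  qed
qed

section \<open>Picone's identity\<close>

lemma x_sq_over_sinh_sq_le:
  fixes x :: real
  assumes "x \<ge> 0"
  shows "x\<^sup>2 / (sinh x)\<^sup>2 \<le> 16 * exp (- x)"
proof (cases "x = 0")
  case False
  with assms have x: "x > 0"
    by simp
  \<comment> \<open>These two bounds yield \<open>sinh x \<ge> exp (x / 2) * (x / 4)\<close>, which
    captures both the simple zero at 0 and exponential growth; squaring it gives the integrable
    majorant.\<close>
  have "exp (x / 2) \<ge> 1 + x / 2" "exp (- (3 * x / 2)) \<le> 1"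
    using x by auto
  then have "x / 2 \<le> exp (x / 2) - exp (- (3 * x / 2))"
    using add_mono[of "1 + x / 2" "exp (x / 2)" "exp (- (3 * x / 2))" 1] by simp
  then have "x / 4 \<le> (exp (x / 2) - exp (- (3 * x / 2))) / 2"
    by (simp only: pos_le_divide_eq zero_less_numeral)
  then have "exp (x / 2) * (x / 4) \<le> exp (x / 2) * ((exp (x / 2) - exp (- (3 * x / 2))) / 2)"
    by (intro mult_left_mono) auto
  also have "\<dots> = (exp (x / 2 + x / 2) - exp (x / 2 + - (3 * x / 2))) / 2"
    unfolding exp_add by (simp add: right_diff_distrib)
  also have "\<dots> = sinh x"
    by (simp add: sinh_def)
  finally have "(exp (x / 2) * (x / 4))\<^sup>2 \<le> (sinh x)\<^sup>2"
    using x by (intro power_mono) auto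
  moreover have "(exp (x / 2) * (x / 4))\<^sup>2 = exp x * x\<^sup>2 / 16"
    by (simp add: power_mult_distrib power_divide exp_double[symmetric])
  ultimately have "exp x * x\<^sup>2 \<le> 16 * (sinh x)\<^sup>2"
    by simp
  then have "x\<^sup>2 \<le> 16 * exp (- x) * (sinh x)\<^sup>2"
    by (simp add: exp_minus field_simps)
  then show ?thesis
    using x by (simp add: divide_le_eq)
qed simp

lemma absolutely_integrable_x_sq_over_sinh_sq:
  "(\<lambda>x::real. x\<^sup>2 / (sinh x)\<^sup>2) absolutely_integrable_on {0..}"
proof (rule measurable_bounded_by_integrable_imp_absolutely_integrable)
  show "(\<lambda>x::real. x\<^sup>2 / (sinh x)\<^sup>2) \<in> borel_measurable (lebesgue_on {0..})"
  proof -
    have "(sinh :: real \<Rightarrow> real) \<in> borel_measurable borel"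
      by (intro borel_measurable_continuous_onI continuous_intros)
    then have "(\<lambda>x::real. x\<^sup>2 / (sinh x)\<^sup>2) \<in> borel_measurable borel"
      by measurable
    then show ?thesis
      by (simp add: borel_measurable_if_D measurable_completion measurable_restrict_space1)
  qed
  show "(\<lambda>x::real. 16 * exp (- x)) integrable_on {0..}"
    using integrable_on_exp_minus_to_infinity[of 1 0] by (intro integrable_on_mult_right) auto
  show "norm (x\<^sup>2 / (sinh x)\<^sup>2) \<le> 16 * exp (- x)" if "x \<in> {0..}" for x :: real
    using x_sq_over_sinh_sq_le[of x] that by simp
qed auto

lemma integrable_x_sq_over_sinh_sq:
  fixes S :: "real set"
  assumes "S \<in> sets lebesgue" "S \<subseteq> {0..}"
  shows "(\<lambda>x::real. x\<^sup>2 / (sinh x)\<^sup>2) integrable_on S"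
  using set_integrable_subset[OF absolutely_integrable_x_sq_over_sinh_sq assms]
  by (rule set_lebesgue_integral_eq_integral(1))

lemma integral_x_sq_over_sinh_sq_le:
  fixes R :: real
  shows "integral {0..R} (\<lambda>x. x\<^sup>2 / (sinh x)\<^sup>2) \<le> integral {0<..} (\<lambda>x. x\<^sup>2 / (sinh x)\<^sup>2)"
proof -
  have "integral {0..R} (\<lambda>x. x\<^sup>2 / (sinh x)\<^sup>2) \<le> integral {0..} (\<lambda>x. x\<^sup>2 / (sinh x)\<^sup>2)"
    by (intro integral_subset_le integrable_x_sq_over_sinh_sq) auto
  also have "\<dots> = integral {0<..} (\<lambda>x. x\<^sup>2 / (sinh x)\<^sup>2)"
    by (rule integral_spike_set; rule negligible_subset[of "{0::real}"]) auto
  finally show ?thesis .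
qed

text \<open>Strict positivity lets the integral be cancelled at the end of Picone's argument; the
  interval \<open>{1..2}\<close> avoids the default value of the integrand at 0.\<close>

lemma integral_x_sq_over_sinh_sq_pos:
  "integral {0<..} (\<lambda>x::real. x\<^sup>2 / (sinh x)\<^sup>2) > 0"
proof -
  have "0 < 1 / (sinh 2)\<^sup>2 * (2 - 1 :: real)"
    by simp
  also have "\<dots> = integral {1..2} (\<lambda>x::real. 1 / (sinh 2)\<^sup>2)"
    by simp
  also have "\<dots> \<le> integral {1..2} (\<lambda>x::real. x\<^sup>2 / (sinh x)\<^sup>2)"
  proof (rule integral_le)
    show "1 / (sinh 2)\<^sup>2 \<le> x\<^sup>2 / (sinh x)\<^sup>2" if "x \<in> {1..2}" for x :: real
      using that by (intro frac_le power_mono) auto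
  qed (auto intro!: integrable_x_sq_over_sinh_sq)
  also have "\<dots> \<le> integral {0..2} (\<lambda>x::real. x\<^sup>2 / (sinh x)\<^sup>2)"
    by (intro integral_subset_le integrable_x_sq_over_sinh_sq) auto
  also have "\<dots> \<le> integral {0<..} (\<lambda>x::real. x\<^sup>2 / (sinh x)\<^sup>2)"
    by (rule integral_x_sq_over_sinh_sq_le)
  finally show ?thesis .
qed

section \<open>The radial equation in the geodesic distance\<close>

lemma coth_eq_tanh_half:
  fixes r :: real
  assumes "r > 0"
  shows "cosh r / sinh r = (1 + (tanh (r / 2))\<^sup>2) / (2 * tanh (r / 2))"
proof -
  define c s where "c = cosh (r / 2)" and "s = sinh (r / 2)"
  have pos: "c > 0" "s > 0"
    using assms by (auto simp: c_def s_def)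
  have "cosh r = c\<^sup>2 + s\<^sup>2" "sinh r = 2 * s * c"
    using cosh_double[of "r / 2"] sinh_double[of "r / 2"] by (auto simp: c_def s_def)
  then show ?thesis
    unfolding tanh_def c_def[symmetric] s_def[symmetric] using pos
    by (simp add: field_simps power2_eq_square)
qed

text \<open>With \<open>t = tanh (r / 2)\<close> and \<open>s = t\<^sup>2\<close> one has
  \<open>ds/dr = t (1 - t\<^sup>2)\<close>, and the equation becomes
  \<open>\<phi>'' + (n - 1) coth r \<phi>' + l \<phi> = 0\<close>. The formula for
  \<open>\<phi>'\<close> stays regular at \<open>r = 0\<close>, where this equation is
  singular.\<close>

lemma radial_sol_geodesic:
  fixes r l :: real
  assumes n: "n \<ge> 2" and r: "r > 0"
  defines "\<phi> \<equiv> \<lambda>r::real. radial_sol n l ((tanh (r / 2))\<^sup>2)"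
  defines "\<phi>' \<equiv> \<lambda>r::real. tanh (r / 2) * (1 - (tanh (r / 2))\<^sup>2) * radial_sol1 n l ((tanh (r / 2))\<^sup>2)"
  shows "(\<phi> has_real_derivative \<phi>' r) (at r)"
    and "(\<phi>' has_real_derivative - l * \<phi> r - (n - 1) * (cosh r / sinh r) * \<phi>' r) (at r)"
proof -
  define t where "t = tanh (r / 2)"
  have t: "0 < t" "t < 1"
    using tanh_half_bounds[OF r] by (auto simp: t_def)
  have t2: "\<bar>t\<^sup>2\<bar> < 1"
    using t by (simp add: abs_square_less_1)
  have dt: "((\<lambda>r::real. tanh (r / 2)) has_real_derivative (1 - t\<^sup>2) / 2) (at r)"
    unfolding t_def by (auto intro!: derivative_eq_intros)
  have dt2: "((\<lambda>r::real. (tanh (r / 2))\<^sup>2) has_real_derivative t * (1 - t\<^sup>2)) (at r)"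
    using dt by (auto intro!: derivative_eq_intros simp: t_def)
  have dF: "((\<lambda>r. radial_sol n l ((tanh (r / 2))\<^sup>2)) has_real_derivative radial_sol1 n l (t\<^sup>2) * (t * (1 - t\<^sup>2))) (at r)"
    by (rule DERIV_chain2[OF _ dt2]) (use radial_sol_derivs(1)[OF n t2] in \<open>simp add: t_def\<close>)
  have dF1: "((\<lambda>r. radial_sol1 n l ((tanh (r / 2))\<^sup>2)) has_real_derivative radial_sol2 n l (t\<^sup>2) * (t * (1 - t\<^sup>2))) (at r)"
    by (rule DERIV_chain2[OF _ dt2]) (use radial_sol_derivs(2)[OF n t2] in \<open>simp add: t_def\<close>)
  show "(\<phi> has_real_derivative \<phi>' r) (at r)"
    unfolding \<phi>_def \<phi>'_def using dF by (simp add: t_def mult_ac)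
  have "(\<phi>' has_real_derivative ((1 - t\<^sup>2) / 2 * (1 - t\<^sup>2) - t * (t * (1 - t\<^sup>2))) * radial_sol1 n l (t\<^sup>2)
      + t * (1 - t\<^sup>2) * (radial_sol2 n l (t\<^sup>2) * (t * (1 - t\<^sup>2)))) (at r)"
    unfolding \<phi>'_def by (rule dt dt2 dF1 refl derivative_eq_intros)+ (simp add: t_def algebra_simps)
  moreover have "((1 - t\<^sup>2) / 2 * (1 - t\<^sup>2) - t * (t * (1 - t\<^sup>2))) * radial_sol1 n l (t\<^sup>2)
      + t * (1 - t\<^sup>2) * (radial_sol2 n l (t\<^sup>2) * (t * (1 - t\<^sup>2)))
    = - l * \<phi> r - (n - 1) * (cosh r / sinh r) * \<phi>' r"
  proof -
    define A B D where "A = radial_sol n l (t\<^sup>2)" and "B = radial_sol1 n l (t\<^sup>2)" and "D = radial_sol2 n l (t\<^sup>2)"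
    have "t\<^sup>2 * (1 - t\<^sup>2)\<^sup>2 * D = - l * A - (n / 2 * (1 - t\<^sup>2)\<^sup>2 + (n - 2) * t\<^sup>2 * (1 - t\<^sup>2)) * B"
      using radial_sol_ode[OF n t2, of l] by (simp add: radial_laplacian_def A_def B_def D_def)
    moreover have "(cosh r / sinh r) * \<phi>' r = (1 + t\<^sup>2) / 2 * (1 - t\<^sup>2) * B"
      unfolding coth_eq_tanh_half[OF r] \<phi>'_def t_def[symmetric] B_def using t by simp
    moreover have "t * (1 - t\<^sup>2) * (D * (t * (1 - t\<^sup>2))) = t\<^sup>2 * (1 - t\<^sup>2)\<^sup>2 * D"
      by (simp add: power2_eq_square)
    moreover have "\<phi> r = A"
      by (simp add: \<phi>_def A_def t_def)
    moreover have "(n - 1) * (cosh r / sinh r) * \<phi>' r = (n - 1) * ((cosh r / sinh r) * \<phi>' r)"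
      by (rule mult.assoc)
    ultimately show ?thesis
      unfolding A_def[symmetric] B_def[symmetric] D_def[symmetric]
      by (simp only:) (simp add: field_simps power2_eq_square)
  qed
  ultimately show "(\<phi>' has_real_derivative - l * \<phi> r - (n - 1) * (cosh r / sinh r) * \<phi>' r) (at r)"
    by simp
qed

lemma radial_sol_at_0: "radial_sol n l 0 = 1"
  by (simp add: radial_sol_def)

text \<open>Picone's identity with the test function \<open>sinh r powr (-m/2) * sin (\<pi> r / R)\<close>. In terms of
  \<open>y = \<phi>'/\<phi> + (m/2) coth r\<close> the radial equation is the Riccati equation
  \<open>y' = m\<^sup>2/4 - l - y\<^sup>2 + m (m - 2) / (4 sinh\<^sup>2 r)\<close>, and \<open>g\<^sup>2 y\<close> vanishes at both ends.\<close>

lemma radial_sol_pos_imp_less: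
  fixes n R l :: real
  assumes n: "n \<ge> 2" and R: "R > 0"
    and pos: "\<And>s. 0 \<le> s \<Longrightarrow> s \<le> (tanh (R / 2))\<^sup>2 \<Longrightarrow> radial_sol n l s > 0"
  defines "C \<equiv> pi\<^sup>2 * (n\<^sup>2 - 1) / 2 * integral {0<..} (\<lambda>r::real. r\<^sup>2 / (sinh r)\<^sup>2)"
  shows "l < (n - 1)\<^sup>2 / 4 + pi\<^sup>2 / R\<^sup>2 + C / R ^ 3"
proof (rule ccontr)
  assume neg: "\<not> ?thesis"
  define m where "m = n - 1"
  \<comment> \<open>The coefficient \<open>m * (m - 2) / 4\<close> of the Riccati potential is
    negative for \<open>m = 1\<close>; its positive part gives a bound valid in every
    dimension.\<close>
  define c where "c = max 0 (m * (m - 2) / 4)"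
  define I where "I = integral {0<..} (\<lambda>r::real. r\<^sup>2 / (sinh r)\<^sup>2)"
  define J where "J = (\<lambda>r. integral {0..r} (\<lambda>r::real. r\<^sup>2 / (sinh r)\<^sup>2))"
  define \<omega> where "\<omega> = pi / R"
  define \<phi> where "\<phi> = (\<lambda>r::real. radial_sol n l ((tanh (r / 2))\<^sup>2))"
  define \<phi>' where "\<phi>' = (\<lambda>r::real. tanh (r / 2) * (1 - (tanh (r / 2))\<^sup>2) * radial_sol1 n l ((tanh (r / 2))\<^sup>2))"
  define y where "y = (\<lambda>r. \<phi>' r / \<phi> r + m / 2 * (cosh r / sinh r))"
  \<comment> \<open>Integrated form of the identity: the added terms are primitives of
    \<open>- \<omega>\<^sup>2 cos (2 \<omega> r)\<close>,
    \<open>C / R^3 sin\<^sup>2 (\<omega> r)\<close> and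
    \<open>- c \<omega>\<^sup>2 r\<^sup>2 / sinh\<^sup>2 r\<close>. With them the derivative is
    minus a square plus two nonpositive terms, so the inequality becomes monotonicity of one
    function.\<close>
  define G where "G = (\<lambda>r. (sin (\<omega> * r))\<^sup>2 * y r - \<omega> / 2 * sin (2 * \<omega> * r)
    + C / R ^ 3 * (r / 2 - sin (2 * \<omega> * r) / (4 * \<omega>)) - c * \<omega>\<^sup>2 * J r)"
  have CI: "C = pi\<^sup>2 * (n\<^sup>2 - 1) / 2 * I"
    by (simp only: C_def I_def)
  have l: "l - m\<^sup>2 / 4 \<ge> \<omega>\<^sup>2 + C / R ^ 3"
    using neg by (simp add: m_def \<omega>_def power_divide)
  have m: "m \<ge> 1"
    using n by (simp add: m_def)
  have \<omega>: "\<omega> > 0"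
    using R by (simp add: \<omega>_def)
  have \<phi>pos: "\<phi> r > 0" if "0 \<le> r" "r \<le> R" for r
    unfolding \<phi>_def by (rule pos) (use that in \<open>auto intro!: power_mono\<close>)
  have dG: "(G has_real_derivative
      (- (sin (\<omega> * r) * y r - \<omega> * cos (\<omega> * r))\<^sup>2 - (l - m\<^sup>2 / 4 - \<omega>\<^sup>2 - C / R ^ 3) * (sin (\<omega> * r))\<^sup>2
       + (m * (m - 2) / 4 * (sin (\<omega> * r))\<^sup>2 - c * (\<omega> * r)\<^sup>2) / (sinh r)\<^sup>2)) (at r)"
    if r: "0 < r" "r < R" for r
  proof -
    have sh: "sinh r > 0"
      using r by simp
    have d: "(\<phi> has_real_derivative \<phi>' r) (at r)"
      "(\<phi>' has_real_derivative - l * \<phi> r - m * (cosh r / sinh r) * \<phi>' r) (at r)"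
      unfolding \<phi>_def \<phi>'_def m_def by (rule radial_sol_geodesic[OF n r(1)])+
    have nz: "\<phi> r \<noteq> 0"
      using \<phi>pos[of r] r by auto
    have quot: "((- l * F - m * h * P) * F - P * P) / (F * F) = - l - m * h * (P / F) - (P / F)\<^sup>2"
      if "F \<noteq> 0" for F P h :: real
      using that by (simp add: field_simps power2_eq_square)
    have dp: "((\<lambda>r. \<phi>' r / \<phi> r) has_real_derivative
        - l - m * (cosh r / sinh r) * (\<phi>' r / \<phi> r) - (\<phi>' r / \<phi> r)\<^sup>2) (at r)"
      by (rule DERIV_cong[OF DERIV_divide[OF d(2,1) nz] quot[OF nz]])
    \<comment> \<open>This merges \<open>m\<^sup>2 / 4 * coth\<^sup>2\<close> and
      \<open>- m / 2 / sinh\<^sup>2\<close> into the constant \<open>m\<^sup>2 / 4\<close> and the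
      potential of the Riccati equation.\<close>
    have coth2: "(cosh r / sinh r)\<^sup>2 = 1 + 1 / (sinh r)\<^sup>2"
      using sh by (simp add: power_divide cosh_square_eq add_divide_distrib)
    have dc: "((\<lambda>r. cosh r / sinh r) has_real_derivative - 1 / (sinh r)\<^sup>2) (at r)"
      using sh cosh_square_eq[of r]
      by (auto intro!: derivative_eq_intros simp: power2_eq_square)
    have "(y has_real_derivative (- l - m * (cosh r / sinh r) * (\<phi>' r / \<phi> r) - (\<phi>' r / \<phi> r)\<^sup>2)
        + m / 2 * (- 1 / (sinh r)\<^sup>2)) (at r)"
      unfolding y_def by (intro DERIV_add dp DERIV_cmult dc)
    then have dy: "(y has_real_derivative m\<^sup>2 / 4 - l - (y r)\<^sup>2 + m * (m - 2) / 4 / (sinh r)\<^sup>2) (at r)"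
    proof (rule DERIV_cong)
      define p h where "p = \<phi>' r / \<phi> r" and "h = cosh r / sinh r"
      have "y r = p + m / 2 * h"
        by (simp only: y_def p_def h_def)
      then have "(y r)\<^sup>2 = p\<^sup>2 + m * h * p + m\<^sup>2 / 4 * h\<^sup>2"
        by (simp add: power2_eq_square algebra_simps)
      then show "(- l - m * (cosh r / sinh r) * (\<phi>' r / \<phi> r) - (\<phi>' r / \<phi> r)\<^sup>2) + m / 2 * (- 1 / (sinh r)\<^sup>2)
        = m\<^sup>2 / 4 - l - (y r)\<^sup>2 + m * (m - 2) / 4 / (sinh r)\<^sup>2"
        unfolding p_def[symmetric] h_def[symmetric] coth2[folded h_def]
          divide_inverse[of _ "(sinh r)\<^sup>2"]
        by (simp add: algebra_simps power2_eq_square)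
    qed
    have dJ: "(J has_real_derivative r\<^sup>2 / (sinh r)\<^sup>2) (at r)"
    proof -
      have "(J has_vector_derivative r\<^sup>2 / (sinh r)\<^sup>2) (at r within {0..R})"
        unfolding J_def
      proof (rule integral_has_vector_derivative_continuous_at[where S="{}", unfolded Diff_empty])
        show "continuous (at r within {0..R}) (\<lambda>r. r\<^sup>2 / (sinh r)\<^sup>2)"
        proof (rule continuous_at_imp_continuous_at_within)
          show "isCont (\<lambda>r::real. r\<^sup>2 / (sinh r)\<^sup>2) r"
            using sh by (intro isCont_divide isCont_power isCont_sinh continuous_ident) simp
        qed
      next
        show "(\<lambda>r. r\<^sup>2 / (sinh r)\<^sup>2) integrable_on {0..R}"
          by (rule integrable_x_sq_over_sinh_sq) auto
      qed (use r in simp_all)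
      moreover have "at r within {0..R} = at r"
        by (rule at_within_interior) (use r in auto)
      ultimately show ?thesis
        by (simp add: has_real_derivative_iff_has_vector_derivative)
    qed
    have "(G has_real_derivative 2 * (sin (\<omega> * r) * (\<omega> * cos (\<omega> * r))) * y r
        + (sin (\<omega> * r))\<^sup>2 * (m\<^sup>2 / 4 - l - (y r)\<^sup>2 + m * (m - 2) / 4 / (sinh r)\<^sup>2)
        - \<omega>\<^sup>2 * cos (2 * \<omega> * r) + C / R ^ 3 * (1 / 2 - cos (2 * \<omega> * r) / 2)
        - c * \<omega>\<^sup>2 * (r\<^sup>2 / (sinh r)\<^sup>2)) (at r)"
    proof -
      have g: "((\<lambda>r. (sin (\<omega> * r))\<^sup>2) has_real_derivative 2 * (sin (\<omega> * r) * (\<omega> * cos (\<omega> * r)))) (at r)"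
        by (auto intro!: derivative_eq_intros)
      have g2: "((\<lambda>r. sin (2 * \<omega> * r)) has_real_derivative 2 * \<omega> * cos (2 * \<omega> * r)) (at r)"
        by (auto intro!: derivative_eq_intros)
      have "((\<lambda>r. r / 2 - sin (2 * \<omega> * r) / (4 * \<omega>)) has_real_derivative
          1 / 2 - 2 * \<omega> * cos (2 * \<omega> * r) / (4 * \<omega>)) (at r)"
        by (intro DERIV_diff DERIV_cdivide DERIV_ident g2)
      then have g3: "((\<lambda>r. r / 2 - sin (2 * \<omega> * r) / (4 * \<omega>)) has_real_derivative
          1 / 2 - cos (2 * \<omega> * r) / 2) (at r)"
        using \<omega> by simp
      show ?thesis
        unfolding G_def
        by (rule DERIV_cong[OF DERIV_diff[OF DERIV_add[OF DERIV_diff[OF DERIV_mult[OF g dy]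
                DERIV_cmult[OF g2]] DERIV_cmult[OF g3]] DERIV_cmult[OF dJ]]])
           (simp add: power2_eq_square)
    qed
    then show ?thesis
    proof (rule DERIV_cong)
      define S K where "S = sin (\<omega> * r)" and "K = cos (\<omega> * r)"
      have S2: "S\<^sup>2 = 1 - K\<^sup>2"
        by (simp add: S_def K_def sin_squared_eq)
      have c2: "cos (2 * \<omega> * r) = K\<^sup>2 - S\<^sup>2"
        using cos_double[of "\<omega> * r"] by (simp add: K_def S_def mult.assoc)
      have c3: "1 / 2 - cos (2 * \<omega> * r) / 2 = S\<^sup>2"
        unfolding c2 using S2 by (simp add: field_simps)
      show "2 * (sin (\<omega> * r) * (\<omega> * cos (\<omega> * r))) * y r
        + (sin (\<omega> * r))\<^sup>2 * (m\<^sup>2 / 4 - l - (y r)\<^sup>2 + m * (m - 2) / 4 / (sinh r)\<^sup>2)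
        - \<omega>\<^sup>2 * cos (2 * \<omega> * r) + C / R ^ 3 * (1 / 2 - cos (2 * \<omega> * r) / 2)
        - c * \<omega>\<^sup>2 * (r\<^sup>2 / (sinh r)\<^sup>2)
       = - (sin (\<omega> * r) * y r - \<omega> * cos (\<omega> * r))\<^sup>2 - (l - m\<^sup>2 / 4 - \<omega>\<^sup>2 - C / R ^ 3) * (sin (\<omega> * r))\<^sup>2
       + (m * (m - 2) / 4 * (sin (\<omega> * r))\<^sup>2 - c * (\<omega> * r)\<^sup>2) / (sinh r)\<^sup>2"
        unfolding c3 unfolding c2 S_def[symmetric] K_def[symmetric] divide_inverse[of _ "(sinh r)\<^sup>2"]
        by (simp add: algebra_simps power2_eq_square)
    qed
  qed
  have "G R \<le> G 0"
  proof (rule DERIV_nonpos_imp_decreasing_open[of 0 R G])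
    show "\<exists>d. DERIV G r :> d \<and> d \<le> 0" if r: "0 < r" "r < R" for r
    proof (intro exI conjI)
      have "(sin (\<omega> * r))\<^sup>2 \<le> (\<omega> * r)\<^sup>2"
        using abs_sin_x_le_abs_x[of "\<omega> * r"] by (simp add: abs_le_square_iff)
      then have "m * (m - 2) / 4 * (sin (\<omega> * r))\<^sup>2 \<le> c * (\<omega> * r)\<^sup>2"
        by (intro mult_mono) (auto simp: c_def)
      then have "(m * (m - 2) / 4 * (sin (\<omega> * r))\<^sup>2 - c * (\<omega> * r)\<^sup>2) / (sinh r)\<^sup>2 \<le> 0"
        by (intro divide_nonpos_nonneg) auto
      moreover have "(l - m\<^sup>2 / 4 - \<omega>\<^sup>2 - C / R ^ 3) * (sin (\<omega> * r))\<^sup>2 \<ge> 0"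
        using l by (intro mult_nonneg_nonneg) auto
      moreover have "(sin (\<omega> * r) * y r - \<omega> * cos (\<omega> * r))\<^sup>2 \<ge> 0"
        by simp
      ultimately show "- (sin (\<omega> * r) * y r - \<omega> * cos (\<omega> * r))\<^sup>2 - (l - m\<^sup>2 / 4 - \<omega>\<^sup>2 - C / R ^ 3) * (sin (\<omega> * r))\<^sup>2
       + (m * (m - 2) / 4 * (sin (\<omega> * r))\<^sup>2 - c * (\<omega> * r)\<^sup>2) / (sinh r)\<^sup>2 \<le> 0"
        by linarith
    qed (rule dG[OF r])
    show "continuous_on {0..R} G"
    proof -
      have t1: "(tanh (r / 2))\<^sup>2 < 1" for r :: real
        by (simp add: abs_square_less_1 tanh_real_lt_1 abs_less_iff tanh_real_gt_neg1 minus_less_iff)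
      have ct: "continuous_on {0..R} (\<lambda>r::real. (tanh (r / 2))\<^sup>2)"
        by (intro continuous_intros) auto
      have img: "(\<lambda>r. (tanh (r / 2))\<^sup>2) ` {0..R} \<subseteq> {-1<..<1}"
        using t1 by (simp add: image_subset_iff less_le_trans[of "-1" 0])
      have "continuous_on {-1<..<1} (radial_sol n l)"
        by (intro continuous_at_imp_continuous_on ballI DERIV_isCont[OF radial_sol_derivs(1)[OF n]]) auto
      then have "continuous_on {0..R} \<phi>"
        unfolding \<phi>_def by (rule continuous_on_compose2[OF _ ct img])
      moreover have "continuous_on {-1<..<1} (radial_sol1 n l)"
        by (intro continuous_at_imp_continuous_on ballI DERIV_isCont[OF radial_sol_derivs(2)[OF n]]) auto
      then have "continuous_on {0..R} (\<lambda>r. radial_sol1 n l ((tanh (r / 2))\<^sup>2))"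
        by (rule continuous_on_compose2[OF _ ct img])
      ultimately have 1: "continuous_on {0..R} (\<lambda>r. \<phi>' r / \<phi> r)"
        unfolding \<phi>'_def using \<phi>pos
        by (intro continuous_intros) (auto simp: less_imp_neq[symmetric])
      \<comment> \<open>The simple pole of \<open>coth\<close> at 0 is beaten by the double zero of
        \<open>sin\<^sup>2\<close>; the limit 0 agrees with the value that division by zero gives at
        \<open>r = 0\<close>.\<close>
      have 2: "continuous_on {0..R} (\<lambda>r. (sin (\<omega> * r))\<^sup>2 * (cosh r / sinh r))"
        unfolding continuous_on_eq_continuous_within
      proof
        fix r assume r: "r \<in> {0..R}"
        show "continuous (at r within {0..R}) (\<lambda>r. (sin (\<omega> * r))\<^sup>2 * (cosh r / sinh r))"
        proof (cases "r = 0")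
          case True
          have "((\<lambda>r. (sin (\<omega> * r))\<^sup>2 * (cosh r / sinh r)) \<longlongrightarrow> 0) (at 0)"
            using \<omega> by real_asymp
          then show ?thesis
            unfolding True continuous_within by (auto intro: tendsto_within_subset)
        next
          case False
          then show ?thesis
            using r by (intro continuous_intros) auto
        qed
      qed
      have 3: "continuous_on {0..R} J"
        unfolding J_def by (intro indefinite_integral_continuous_1 integrable_x_sq_over_sinh_sq) auto
      have "G = (\<lambda>r. (sin (\<omega> * r))\<^sup>2 * (\<phi>' r / \<phi> r) + m / 2 * ((sin (\<omega> * r))\<^sup>2 * (cosh r / sinh r)) - \<omega> / 2 * sin (2 * \<omega> * r)
        + C / R ^ 3 * (r / 2 - sin (2 * \<omega> * r) / (4 * \<omega>)) - c * \<omega>\<^sup>2 * J r)"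
        by (simp add: G_def y_def distrib_left mult_ac)
      then show ?thesis
        using \<omega> by (simp only:) (intro continuous_intros 1 2 3; simp)
    qed
  qed (use R in simp)
  moreover have "G 0 = 0"
    by (simp add: G_def J_def)
  moreover have "\<omega> * R = pi"
    using R by (simp add: \<omega>_def)
  \<comment> \<open>\<open>sin (\<omega> * R) = sin pi = 0\<close> removes \<open>y R\<close>. No
    boundary condition at \<open>R\<close> enters, which is why the upper bound is uniform in
    \<open>\<sigma>\<close>.\<close>
  then have "G R = C / R ^ 3 * (R / 2) - c * \<omega>\<^sup>2 * J R"
    by (simp add: G_def mult.assoc)
  ultimately have "C / R ^ 3 * (R / 2) \<le> c * \<omega>\<^sup>2 * J R"
    by simp
  then have "C / 2 \<le> c * pi\<^sup>2 * J R"
    using R by (simp add: \<omega>_def field_simps power2_eq_square power3_eq_cube)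
  also have "\<dots> \<le> c * pi\<^sup>2 * I"
    unfolding J_def I_def by (intro mult_left_mono integral_x_sq_over_sinh_sq_le) (auto simp: c_def)
  \<comment> \<open>Here \<open>n\<^sup>2 - 1 = m * (m + 2)\<close>; since \<open>m \<ge> 1\<close>,
    the number \<open>m * (m + 2) / 4\<close> strictly exceeds both candidates in the maximum
    \<open>c\<close>.\<close>
  finally have "pi\<^sup>2 * I * (m * (m + 2) / 4) \<le> pi\<^sup>2 * I * c"
    by (simp add: CI m_def field_simps power2_eq_square)
  moreover have "pi\<^sup>2 * I > 0"
    using integral_x_sq_over_sinh_sq_pos by (simp add: I_def)
  ultimately have "m * (m + 2) / 4 \<le> c"
    by (simp only: mult_le_cancel_left_pos)
  moreover have "0 < m * (m + 2) / 4" "m * (m - 2) < m * (m + 2)"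
    using m by auto
  ultimately show False
    by (auto simp: c_def)
qed

section \<open>Existence of a small eigenvalue\<close>

lemma radial_coeff_0: "radial_coeff n 0 (Suc k) = 0"
proof -
  have "radial_coeff n 0 (Suc k) = 0 \<and> radial_coeff n 0 (Suc (Suc k)) = 0"
    by (induction k) auto
  then show ?thesis ..
qed

lemma radial_sol_0: "radial_sol n 0 s = 1"
proof -
  have "(\<lambda>k. radial_coeff n 0 k * s ^ k) sums (\<Sum>k\<in>{0}. radial_coeff n 0 k * s ^ k)"
    by (rule sums_finite) (auto simp: radial_coeff_0 gr0_conv_Suc)
  then show ?thesis
    by (simp add: radial_sol_def sums_iff)
qed

text \<open>\<open>W\<close> is the integrating factor that puts the equation in divergence form,
  \<open>(W P')' = - l W P / (s (1 - s)^2)\<close>; up to the factor \<open>2^(n-1)\<close>,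
  \<open>W P'\<close> is \<open>sinh^(n-1) r\<close> times the geodesic derivative. It vanishes at 0
  and decreases as long as the solution is nonnegative.\<close>

lemma radial_sol1_nonpos:
  assumes n: "n \<ge> 2" and l: "l \<ge> 0" and t: "0 < t" "t < 1"
    and nonneg: "\<And>s. 0 \<le> s \<Longrightarrow> s \<le> t \<Longrightarrow> radial_sol n l s \<ge> 0"
  shows "radial_sol1 n l t \<le> 0"
proof -
  define W where "W = (\<lambda>s. s powr (n / 2) * (1 - s) powr (2 - n))"
  have "W t * radial_sol1 n l t \<le> W 0 * radial_sol1 n l 0"
  proof (rule DERIV_nonpos_imp_decreasing_open[of 0 t "\<lambda>s. W s * radial_sol1 n l s"])
    show "0 \<le> t"
      using t by simp
    show "continuous_on {0..t} (\<lambda>s. W s * radial_sol1 n l s)"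
    proof (rule continuous_on_mult)
      show "continuous_on {0..t} W"
        unfolding W_def using n t by (intro continuous_intros continuous_on_powr') auto
      show "continuous_on {0..t} (radial_sol1 n l)"
        using t by (intro continuous_at_imp_continuous_on ballI DERIV_isCont[OF radial_sol_derivs(2)[OF n]]) auto
    qed
    show "\<exists>d. DERIV (\<lambda>s. W s * radial_sol1 n l s) s :> d \<and> d \<le> 0" if s: "0 < s" "s < t" for s
    proof (intro exI conjI)
      have s1: "\<bar>s\<bar> < 1" "s < 1"
        using s t by auto
      have dW: "(W has_real_derivative W s * (n / 2 / s + (n - 2) / (1 - s))) (at s)"
      proof -
        have "((\<lambda>s. s powr (n / 2)) has_real_derivative s powr (n / 2) * (n / 2 / s)) (at s)"
          using s by (auto intro!: derivative_eq_intros simp: powr_diff)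
        moreover have "((\<lambda>s. (1 - s) powr (2 - n)) has_real_derivative
            (1 - s) powr (2 - n) * ((n - 2) / (1 - s))) (at s)"
        proof (rule DERIV_cong)
          show "((\<lambda>s. (1 - s) powr (2 - n)) has_real_derivative - (2 - n) * (1 - s) powr (2 - n - 1)) (at s)"
            using s1 by (auto intro!: derivative_eq_intros simp: left_diff_distrib)
          have "(1 - s) powr (2 - n - 1) = (1 - s) powr (2 - n) / (1 - s)"
            using s1 by (simp only: powr_diff) simp
          then show "- (2 - n) * (1 - s) powr (2 - n - 1) = (1 - s) powr (2 - n) * ((n - 2) / (1 - s))"
            by (simp only: minus_diff_eq) simp
        qed
        ultimately show ?thesis
          unfolding W_def by (rule DERIV_cong[OF DERIV_mult]) (simp add: algebra_simps)
      qed
      show "((\<lambda>s. W s * radial_sol1 n l s) has_real_derivative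
          - (l * W s * radial_sol n l s / (s * (1 - s)\<^sup>2))) (at s)"
      proof (rule DERIV_cong[OF DERIV_mult[OF dW radial_sol_derivs(2)[OF n s1(1)]]])
        have "s * (1 - s)\<^sup>2 * radial_sol2 n l s = - l * radial_sol n l s
            - (n / 2 * (1 - s)\<^sup>2 + (n - 2) * s * (1 - s)) * radial_sol1 n l s"
          using radial_sol_ode[OF n s1(1), of l] by (simp add: radial_laplacian_def)
        then have F2: "radial_sol2 n l s = (- l * radial_sol n l s
            - (n / 2 * (1 - s)\<^sup>2 + (n - 2) * s * (1 - s)) * radial_sol1 n l s) / (s * (1 - s)\<^sup>2)"
          using s s1 by (simp add: eq_divide_eq mult_ac)
        have "n / 2 / s + (n - 2) / (1 - s) = (n / 2 * (1 - s)\<^sup>2 + (n - 2) * s * (1 - s)) / (s * (1 - s)\<^sup>2)"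
          using s s1 by (simp add: divide_simps) (simp add: power2_eq_square algebra_simps)
        then show "W s * (n / 2 / s + (n - 2) / (1 - s)) * radial_sol1 n l s + radial_sol2 n l s * W s
          = - (l * W s * radial_sol n l s / (s * (1 - s)\<^sup>2))"
          unfolding F2 by (simp add: diff_divide_distrib mult_ac)
            (simp add: algebra_simps)
      qed
      have "radial_sol n l s \<ge> 0"
        using s by (intro nonneg) auto
      then show "- (l * W s * radial_sol n l s / (s * (1 - s)\<^sup>2)) \<le> 0"
        using l s by (simp add: W_def)
    qed
  qed
  moreover have "W 0 = 0" "W t > 0"
    using t by (auto simp: W_def)
  ultimately show ?thesis
    by (simp add: mult_le_0_iff)
qed

text \<open>For a radial function with value \<open>f\<close> and \<open>s\<close>-derivative
  \<open>f1\<close> on the sphere, this vanishes exactly when the boundary condition holds. Treating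
  Dirichlet and Robin conditions as zeros of one scalar allows an intermediate value argument in
  \<open>l\<close>.\<close>

definition boundary_value :: "ereal \<Rightarrow> real \<Rightarrow> real \<Rightarrow> real \<Rightarrow> real" where
  "boundary_value \<sigma> \<rho> f f1 =
     (if \<sigma> = \<infinity> then f else \<rho> * (1 - \<rho>\<^sup>2) * f1 + real_of_ereal \<sigma> * f)"

text \<open>The value 1 at the origin makes the solution nontrivial, and convergence for all
  \<open>s < 1\<close> lets the whole unit ball serve as the open set \<open>S\<close>.\<close>

lemma radial_robin_eigenfunction:
  assumes n: "DIM('a::euclidean_space) \<ge> 2" and R: "R > 0" and \<rho>: "\<rho> = tanh (R / 2)"
    and bc: "boundary_value \<sigma> \<rho> (radial_sol (real DIM('a)) l (\<rho>\<^sup>2)) (radial_sol1 (real DIM('a)) l (\<rho>\<^sup>2)) = 0"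
  shows "robin_eigenfunction R \<sigma> l (\<lambda>x::'a. radial_sol (real DIM('a)) l ((norm x)\<^sup>2))"
proof -
  define N where "N = real DIM('a)"
  have N: "N \<ge> 2"
    using n by (simp add: N_def)
  have \<rho>01: "0 < \<rho>" "\<rho> < 1"
    using tanh_half_bounds[OF R] by (auto simp: \<rho>)
  have n1: "\<bar>(norm x)\<^sup>2\<bar> < 1" if "norm x < 1" for x :: 'a
    using that by (simp add: abs_square_less_1)
  define Du where "Du = (\<lambda>x h::'a. 2 * radial_sol1 N l ((norm x)\<^sup>2) * (x \<bullet> h))"
  define D2 where "D2 = (\<lambda>x b h::'a. 4 * radial_sol2 N l ((norm x)\<^sup>2) * (x \<bullet> h) * (x \<bullet> b)
    + 2 * radial_sol1 N l ((norm x)\<^sup>2) * (h \<bullet> b))"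
  have c1: "isCont (\<lambda>x::'a. radial_sol1 N l ((norm x)\<^sup>2)) x" if "norm x < 1" for x :: 'a
    using DERIV_isCont[OF radial_sol_derivs(2)[OF N n1[OF that]]]
    by (intro isCont_o2[of x "\<lambda>x. (norm x)\<^sup>2" "radial_sol1 N l"] continuous_intros) auto
  have c2: "isCont (\<lambda>x::'a. radial_sol2 N l ((norm x)\<^sup>2)) x" if "norm x < 1" for x :: 'a
    using radial_sol_derivs(3)[OF N n1[OF that]]
    by (intro isCont_o2[of x "\<lambda>x. (norm x)\<^sup>2" "radial_sol2 N l"] continuous_intros) auto
  have "open (ball (0::'a) 1)" "cball (0::'a) \<rho> \<subseteq> ball 0 1" "ball (0::'a) 1 \<subseteq> ball 0 1"
    using \<rho>01 by auto
  moreover have "\<forall>x\<in>ball 0 1. ((\<lambda>x::'a. radial_sol N l ((norm x)\<^sup>2)) has_derivative Du x) (at x)"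
    unfolding Du_def using n1 by (auto intro!: radial_has_derivative radial_sol_derivs(1)[OF N])
  moreover have "\<forall>b\<in>Basis. continuous_on (ball 0 1) (\<lambda>x. Du x b)"
    unfolding Du_def using c1 by (auto intro!: continuous_at_imp_continuous_on continuous_intros)
  moreover have "\<forall>x\<in>ball 0 \<rho>. \<forall>b\<in>Basis. ((\<lambda>y. Du y b) has_derivative D2 x b) (at x)"
    unfolding Du_def D2_def using n1 \<rho>01
    by (auto intro!: radial_has_second_derivative radial_sol_derivs(2)[OF N])
  moreover have "\<forall>b\<in>Basis. \<forall>c\<in>Basis. continuous_on (ball 0 \<rho>) (\<lambda>x. D2 x b c)"
    unfolding D2_def using c1 c2 \<rho>01
    by (auto intro!: continuous_at_imp_continuous_on continuous_intros)
  moreover have "\<exists>x::'a\<in>ball 0 \<rho>. radial_sol N l ((norm x)\<^sup>2) \<noteq> 0"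
    using \<rho>01 by (intro bexI[of _ 0]) (auto simp: radial_sol_at_0)
  moreover have "\<forall>x::'a\<in>ball 0 \<rho>. hyp_laplacian Du D2 x = l * radial_sol N l ((norm x)\<^sup>2)"
  proof
    fix x :: 'a assume "x \<in> ball 0 \<rho>"
    then have x: "norm x < 1"
      using \<rho>01 by auto
    show "hyp_laplacian Du D2 x = l * radial_sol N l ((norm x)\<^sup>2)"
      unfolding Du_def D2_def hyp_laplacian_radial[OF x] N_def[symmetric]
      by (rule radial_sol_ode[OF N n1[OF x]])
  qed
  moreover have "if \<sigma> = \<infinity> then (\<forall>x::'a\<in>sphere 0 \<rho>. radial_sol N l ((norm x)\<^sup>2) = 0)
         else (\<forall>x\<in>sphere 0 \<rho>. - Du x x / (\<rho> * pc_factor x) = real_of_ereal \<sigma> * radial_sol N l ((norm x)\<^sup>2))"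
  proof (cases "\<sigma> = \<infinity>")
    case True
    then show ?thesis
      using bc by (auto simp: boundary_value_def N_def)
  next
    case False
    have q: "1 - \<rho>\<^sup>2 > 0"
      using \<rho>01 by (simp add: abs_square_less_1)
    have "- Du x x / (\<rho> * pc_factor x) = real_of_ereal \<sigma> * radial_sol N l ((norm x)\<^sup>2)"
      if "x \<in> sphere 0 \<rho>" for x
    proof -
      have nx: "norm x = \<rho>"
        using that by simp
      then have "x \<bullet> x = \<rho>\<^sup>2"
        by (simp add: power2_norm_eq_inner[symmetric])
      then have "- Du x x / (\<rho> * pc_factor x) = - (\<rho> * (1 - \<rho>\<^sup>2) * radial_sol1 N l (\<rho>\<^sup>2))"
        using q \<rho>01 by (simp add: Du_def nx pc_factor_def power2_eq_square)
      then show ?thesis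
        using bc False by (simp add: boundary_value_def N_def nx)
    qed
    then show ?thesis
      using False by simp
  qed
  ultimately show ?thesis
    unfolding robin_eigenfunction_def Let_def geo_ball_radius_def \<rho>[symmetric] N_def[symmetric]
    by (intro exI[of _ "ball 0 1"] exI[of _ Du] exI[of _ D2] conjI)
qed

text \<open>The maximum principle assumes no boundary condition, so it applies to the radial
  solution itself with \<open>l\<close> below the threshold \<open>\<mu>\<close> of the exponential
  barrier. At the boundary it gives a positive value \<open>F\<close> and
  \<open>k * F \<le> F1\<close>, and \<open>k\<close> was chosen to make the Robin expression
  positive. In the Dirichlet case \<open>l0 = 0\<close> works, its solution being constant.\<close>

lemma boundary_value_pos_of_low_eigenvalue:
  assumes n: "DIM('a::euclidean_space) \<ge> 2" and R: "R > 0" and \<rho>: "\<rho> = tanh (R / 2)"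
  obtains l0 where "l0 \<le> 0"
    "boundary_value \<sigma> \<rho> (radial_sol (real DIM('a)) l0 (\<rho>\<^sup>2)) (radial_sol1 (real DIM('a)) l0 (\<rho>\<^sup>2)) > 0"
proof (cases "\<sigma> = \<infinity>")
  case True
  then show thesis
    by (intro that[of 0]) (auto simp: boundary_value_def radial_sol_0)
next
  case False
  define N where "N = real DIM('a)"
  have N: "N \<ge> 2"
    using n by (simp add: N_def)
  have \<rho>01: "0 < \<rho>" "\<rho> < 1"
    using tanh_half_bounds[OF R] by (auto simp: \<rho>)
  have \<rho>2: "\<rho>\<^sup>2 < 1"
    using \<rho>01 by (simp add: abs_square_less_1)
  define k where "k = (\<bar>real_of_ereal \<sigma>\<bar> + 1) / (\<rho> * (1 - \<rho>\<^sup>2))"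
  note k = exp_boundary_pos[OF \<rho>01 k_def]
  define \<mu> where "\<mu> = - (k\<^sup>2 + 2 * N * k)"
  define l where "l = \<mu> - 1"
  have n1: "\<bar>(norm x)\<^sup>2\<bar> < 1" if "norm x < 1" for x :: 'a
    using that by (simp add: abs_square_less_1)
  obtain x :: 'a where x: "x \<in> sphere 0 \<rho>" "radial_sol N l ((norm x)\<^sup>2) > 0"
    "2 * \<rho>\<^sup>2 * (k * exp (k * \<rho>\<^sup>2)) * radial_sol N l ((norm x)\<^sup>2)
      \<le> 2 * radial_sol1 N l ((norm x)\<^sup>2) * (x \<bullet> x) * exp (k * \<rho>\<^sup>2)"
  proof (rule maximum_principle[where \<rho>=\<rho> and S="ball 0 1" and \<mu>=\<mu> and lam=l
        and u="\<lambda>x::'a. radial_sol N l ((norm x)\<^sup>2)"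
        and Du="\<lambda>x h::'a. 2 * radial_sol1 N l ((norm x)\<^sup>2) * (x \<bullet> h)"
        and ?D2.0="\<lambda>x b h::'a. 4 * radial_sol2 N l ((norm x)\<^sup>2) * (x \<bullet> h) * (x \<bullet> b)
           + 2 * radial_sol1 N l ((norm x)\<^sup>2) * (h \<bullet> b)"
        and P="\<lambda>s. exp (k * s)" and ?P1.0="\<lambda>s. k * exp (k * s)" and ?P2.0="\<lambda>s. k\<^sup>2 * exp (k * s)"
        and ?x1.0=0])
    show "hyp_laplacian (\<lambda>x h::'a. 2 * radial_sol1 N l ((norm x)\<^sup>2) * (x \<bullet> h))
        (\<lambda>x b h::'a. 4 * radial_sol2 N l ((norm x)\<^sup>2) * (x \<bullet> h) * (x \<bullet> b)
           + 2 * radial_sol1 N l ((norm x)\<^sup>2) * (h \<bullet> b)) x = l * radial_sol N l ((norm x)\<^sup>2)"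
      if "x \<in> ball 0 \<rho>" for x
    proof -
      have x: "norm x < 1"
        using that \<rho>01 by auto
      show ?thesis
        unfolding hyp_laplacian_radial[OF x] N_def[symmetric]
        by (rule radial_sol_ode[OF N n1[OF x]])
    qed
    show "\<mu> * exp (k * s) \<le> radial_laplacian (real DIM('a)) s (k * exp (k * s)) (k\<^sup>2 * exp (k * s))"
      if "0 \<le> s" "s < \<rho>\<^sup>2" for s
      unfolding \<mu>_def N_def[symmetric]
      by (rule radial_laplacian_exp_ge) (use that N k \<rho>2 in auto)
    show "((\<lambda>s. exp (k * s)) has_real_derivative k * exp (k * s)) (at s)" for s
      by (auto intro!: derivative_eq_intros)
    show "((\<lambda>s. k * exp (k * s)) has_real_derivative k\<^sup>2 * exp (k * s)) (at s)" for s
      by (auto intro!: derivative_eq_intros simp: power2_eq_square)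
    show "((\<lambda>x. radial_sol N l ((norm x)\<^sup>2)) has_derivative (\<lambda>h. 2 * radial_sol1 N l ((norm x)\<^sup>2) * (x \<bullet> h))) (at x)"
      if "x \<in> ball 0 1" for x :: 'a
      using that n1 by (intro radial_has_derivative radial_sol_derivs(1)[OF N]) auto
    show "((\<lambda>y. 2 * radial_sol1 N l ((norm y)\<^sup>2) * (y \<bullet> b)) has_derivative
       (\<lambda>h. 4 * radial_sol2 N l ((norm x)\<^sup>2) * (x \<bullet> h) * (x \<bullet> b) + 2 * radial_sol1 N l ((norm x)\<^sup>2) * (h \<bullet> b))) (at x)"
      if "x \<in> ball 0 \<rho>" for x b :: 'a
      using that n1 \<rho>01 by (intro radial_has_second_derivative radial_sol_derivs(2)[OF N]) auto
  qed (use \<rho>01 in \<open>auto simp: radial_sol_at_0 l_def\<close>)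
  define F F1 E where "F = radial_sol N l (\<rho>\<^sup>2)" and "F1 = radial_sol1 N l (\<rho>\<^sup>2)" and "E = exp (k * \<rho>\<^sup>2)"
  have nx: "norm x = \<rho>" "x \<bullet> x = \<rho>\<^sup>2"
    using x(1) by (auto simp: power2_norm_eq_inner[symmetric])
  have F: "F > 0"
    using x(2) by (simp add: nx F_def)
  have "2 * \<rho>\<^sup>2 * E * (k * F) \<le> 2 * \<rho>\<^sup>2 * E * F1"
    using x(3) by (simp add: nx F_def F1_def E_def mult_ac)
  moreover have "2 * \<rho>\<^sup>2 * E > 0"
    using \<rho>01 by (simp add: E_def)
  ultimately have "k * F \<le> F1"
    by (simp only: mult_le_cancel_left_pos)
  then have "\<rho> * (1 - \<rho>\<^sup>2) * (k * F) \<le> \<rho> * (1 - \<rho>\<^sup>2) * F1"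
    using \<rho>01 \<rho>2 by (intro mult_left_mono) auto
  moreover have "E * (\<rho> * (1 - \<rho>\<^sup>2) * k + real_of_ereal \<sigma>) > 0"
    using k(2) by (simp add: E_def algebra_simps)
  then have "\<rho> * (1 - \<rho>\<^sup>2) * k + real_of_ereal \<sigma> > 0"
    by (simp add: E_def zero_less_mult_iff)
  then have "(\<rho> * (1 - \<rho>\<^sup>2) * k + real_of_ereal \<sigma>) * F > 0"
    using F by simp
  ultimately have "\<rho> * (1 - \<rho>\<^sup>2) * F1 + real_of_ereal \<sigma> * F > 0"
    by (simp add: distrib_right mult.assoc)
  moreover have "l \<le> 0"
    using k(1) N by (simp add: l_def \<mu>_def add_nonneg_nonneg order_trans[of _ 0])
  ultimately show thesis
    using False by (intro that[of l]) (auto simp: boundary_value_def F_def F1_def N_def)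
qed

text \<open>Suppose there is no zero of \<open>bv\<close> up to \<open>\<Lambda>\<close>. Starting
  from a low \<open>l0\<close> with positive \<open>bv\<close>, the intermediate value theorem keeps
  \<open>bv\<close> positive on \<open>[0, \<Lambda>]\<close>. As \<open>l\<close> increases from 0,
  where the solution is 1, it cannot lose positivity on the closed ball without violating this, so
  Picone's bound applies at \<open>\<Lambda>\<close> and contradicts itself.\<close>

lemma exists_robin_eigenvalue_le:
  assumes n: "DIM('a::euclidean_space) \<ge> 2" and N: "N = real DIM('a)" and R: "R > 0"
    and C: "C = pi\<^sup>2 * (N\<^sup>2 - 1) / 2 * integral {0<..} (\<lambda>r::real. r\<^sup>2 / (sinh r)\<^sup>2)"
  obtains l and u :: "'a::euclidean_space \<Rightarrow> real" where "robin_eigenfunction R \<sigma> l u"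
    "l \<le> (N - 1)\<^sup>2 / 4 + pi\<^sup>2 / R\<^sup>2 + C / R ^ 3"
proof -
  define \<rho> where "\<rho> = tanh (R / 2)"
  define \<Lambda> where "\<Lambda> = (N - 1)\<^sup>2 / 4 + pi\<^sup>2 / R\<^sup>2 + C / R ^ 3"
  define bv where "bv = (\<lambda>l. boundary_value \<sigma> \<rho> (radial_sol N l (\<rho>\<^sup>2)) (radial_sol1 N l (\<rho>\<^sup>2)))"
  have N2: "N \<ge> 2"
    using n N by simp
  have \<rho>01: "0 < \<rho>" "\<rho> < 1"
    using tanh_half_bounds[OF R] by (auto simp: \<rho>_def)
  have \<rho>2: "0 < \<rho>\<^sup>2" "\<rho>\<^sup>2 < 1"
    using \<rho>01 by (auto simp: abs_square_less_1)
  have "N\<^sup>2 \<ge> 1"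
    using N2 by (simp add: one_le_power)
  then have C0: "C \<ge> 0"
    unfolding C using integral_x_sq_over_sinh_sq_pos by (intro mult_nonneg_nonneg) auto
  have \<Lambda>: "\<Lambda> > 0"
    unfolding \<Lambda>_def using R C0 by (intro add_nonneg_pos add_pos_nonneg) auto
  have "\<exists>l\<le>\<Lambda>. bv l = 0"
  proof (rule ccontr)
    assume none: "\<not> (\<exists>l\<le>\<Lambda>. bv l = 0)"
    obtain l0 where l0: "l0 \<le> 0" "bv l0 > 0"
      unfolding bv_def N by (rule boundary_value_pos_of_low_eigenvalue[OF n R \<rho>_def])
    have pair: "continuous_on {l0..\<Lambda>} (\<lambda>l. (\<rho>\<^sup>2, l))"
      by (intro continuous_intros)
    have "continuous_on {l0..\<Lambda>} (\<lambda>l. radial_sol N l (\<rho>\<^sup>2))"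
      using continuous_on_compose2[OF radial_sol_jointly_continuous(1)[OF N2] pair, of "\<rho>\<^sup>2" l0 \<Lambda>] \<rho>2
      by (simp add: image_subset_iff)
    moreover have "continuous_on {l0..\<Lambda>} (\<lambda>l. radial_sol1 N l (\<rho>\<^sup>2))"
      using continuous_on_compose2[OF radial_sol_jointly_continuous(2)[OF N2] pair, of "\<rho>\<^sup>2" l0 \<Lambda>] \<rho>2
      by (simp add: image_subset_iff)
    ultimately have cont: "continuous_on {l0..\<Lambda>} bv"
      unfolding bv_def boundary_value_def by (cases "\<sigma> = \<infinity>") (auto intro!: continuous_intros)
    have bvpos: "bv l > 0" if "0 \<le> l" "l \<le> \<Lambda>" for l
    proof (rule ccontr)
      assume "\<not> bv l > 0"
      then have "\<exists>x\<ge>l0. x \<le> l \<and> bv x = 0"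
        using l0 that by (intro IVT2' continuous_on_subset[OF cont]) auto
      then show False
        using none that by auto
    qed
    define Z where "Z = {p \<in> {0..\<rho>\<^sup>2} \<times> {0..\<Lambda>}. radial_sol N (snd p) (fst p) \<le> 0}"
    have contF: "continuous_on ({0..\<rho>\<^sup>2} \<times> {0..\<Lambda>}) (\<lambda>p. radial_sol N (snd p) (fst p))"
      by (rule radial_sol_jointly_continuous(1)[OF N2]) (use \<rho>2 in auto)
    have "closed Z"
      unfolding Z_def using continuous_closed_preimage[OF contF, of "{..0}"]
      by (simp add: closed_Times vimage_def Int_def)
    moreover have "bounded Z"
      by (rule bounded_subset[of "{0..\<rho>\<^sup>2} \<times> {0..\<Lambda>}"]) (auto simp: Z_def intro!: bounded_Times)
    ultimately have Z: "compact Z"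
      by (simp add: compact_eq_bounded_closed)
    have "Z = {}"
    proof (rule ccontr)
      assume "Z \<noteq> {}"
      \<comment> \<open>A pair with the smallest \<open>l\<close>: for smaller nonnegative
        parameters the solution is positive on the whole ball, so at this \<open>l\<close> it is
        still nonnegative by continuity.\<close>
      then obtain p where p: "p \<in> Z" "\<And>q. q \<in> Z \<Longrightarrow> snd p \<le> snd q"
        using continuous_attains_inf[OF Z _ continuous_on_snd[OF continuous_on_id]] by blast
      define l where "l = snd p"
      have l: "0 \<le> l" "l \<le> \<Lambda>" and s: "0 \<le> fst p" "fst p \<le> \<rho>\<^sup>2" "radial_sol N l (fst p) \<le> 0"
        using p(1) by (auto simp: Z_def l_def)
      have "l \<noteq> 0"
        using s(3) by (auto simp: radial_sol_0)
      then have lpos: "l > 0"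
        using l by simp
      have nonneg: "radial_sol N l s \<ge> 0" if s: "0 \<le> s" "s \<le> \<rho>\<^sup>2" for s
      proof -
        have "continuous_on {0..l} (\<lambda>l. radial_sol N l s)"
        proof -
          have "continuous_on {0..l} (\<lambda>l. (s, l))"
            by (intro continuous_intros)
          then show ?thesis
            using continuous_on_compose2[OF contF, of "{0..l}" "\<lambda>l. (s, l)"] s l
            by (simp add: image_subset_iff)
        qed
        moreover have "radial_sol N l' s > 0" if "l' \<in> {0<..<l}" for l'
        proof (rule ccontr)
          assume "\<not> radial_sol N l' s > 0"
          then have "(s, l') \<in> Z"
            using that s l by (simp add: Z_def)
          then have "l \<le> l'"
            using p(2)[of "(s, l')"] by (simp add: l_def)
          then show False
            using that by simp
        qed
        moreover have "l \<in> closure {0<..<l}" "closure {0<..<l} = {0..l}"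
          using lpos by auto
        ultimately show ?thesis
          using continuous_ge_on_closure[of "{0<..<l}" "\<lambda>l. radial_sol N l s" l 0] by (simp add: less_imp_le)
      qed
      have F1: "radial_sol1 N l s \<le> 0" if "0 < s" "s \<le> \<rho>\<^sup>2" for s
        using that \<rho>2 by (intro radial_sol1_nonpos[OF N2 l(1)] nonneg) auto
      \<comment> \<open>A nonnegative solution decreases in \<open>s\<close>, so a zero anywhere
        forces a zero on the boundary; with a nonpositive derivative there, \<open>bv l\<close>
        cannot be positive.\<close>
      have "radial_sol N l (\<rho>\<^sup>2) \<le> radial_sol N l (fst p)"
      proof (rule DERIV_nonpos_imp_decreasing_open[OF s(2)])
        show "\<exists>d. DERIV (radial_sol N l) x :> d \<and> d \<le> 0" if "fst p < x" "x < \<rho>\<^sup>2" for x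
          using that s \<rho>2 by (intro exI[of _ "radial_sol1 N l x"] conjI radial_sol_derivs(1)[OF N2] F1) auto
        show "continuous_on {fst p..\<rho>\<^sup>2} (radial_sol N l)"
          using s \<rho>2
          by (intro continuous_at_imp_continuous_on ballI DERIV_isCont[OF radial_sol_derivs(1)[OF N2]]) auto
      qed
      then have F0: "radial_sol N l (\<rho>\<^sup>2) = 0"
        using s(3) nonneg[of "\<rho>\<^sup>2"] \<rho>2 by auto
      have "\<rho> * (1 - \<rho>\<^sup>2) * radial_sol1 N l (\<rho>\<^sup>2) \<le> 0"
        using \<rho>01 \<rho>2 F1[of "\<rho>\<^sup>2"] by (intro mult_nonneg_nonpos) auto
      then have "bv l \<le> 0"
        by (simp add: bv_def boundary_value_def F0)
      then show False
        using bvpos[OF l] by simp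
    qed
    have "radial_sol N \<Lambda> s > 0" if "0 \<le> s" "s \<le> \<rho>\<^sup>2" for s
    proof (rule ccontr)
      assume "\<not> radial_sol N \<Lambda> s > 0"
      then have "(s, \<Lambda>) \<in> Z"
        using that \<Lambda> by (simp add: Z_def)
      then show False
        using \<open>Z = {}\<close> by simp
    qed
    then have "\<Lambda> < (N - 1)\<^sup>2 / 4 + pi\<^sup>2 / R\<^sup>2 + C / R ^ 3"
      unfolding C \<rho>_def by (intro radial_sol_pos_imp_less[OF N2 R]) auto
    then show False
      by (simp add: \<Lambda>_def)
  qed
  then obtain l where "l \<le> \<Lambda>" "bv l = 0"
    by blast
  then show thesis
    using radial_robin_eigenfunction[OF n R \<rho>_def, of \<sigma> l] that[of l] by (auto simp: bv_def N \<Lambda>_def)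
qed

section \<open>The two bounds for \<open>lambda1\<close> and the asymptotics\<close>

lemma lambda1_upper:
  assumes n: "DIM('a::euclidean_space) \<ge> 2" and N: "N = real DIM('a)" and R: "R > 0"
    and C: "C = pi\<^sup>2 * (N\<^sup>2 - 1) / 2 * integral {0<..} (\<lambda>r::real. r\<^sup>2 / (sinh r)\<^sup>2)"
  shows "lambda1 TYPE('a) R \<sigma> \<le> (N - 1)\<^sup>2 / 4 + pi\<^sup>2 / R\<^sup>2 + C / R ^ 3"
proof (rule exists_robin_eigenvalue_le[OF n N R C])
  fix l and u :: "'a \<Rightarrow> real"
  assume u: "robin_eigenfunction R \<sigma> l u"
    and l: "l \<le> (N - 1)\<^sup>2 / 4 + pi\<^sup>2 / R\<^sup>2 + C / R ^ 3"
  have "lambda1 TYPE('a) R \<sigma> \<le> l"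
    unfolding lambda1_def using u by (intro cInf_lower robin_spectrum_bdd_below[OF R n]) blast
  then show ?thesis
    using l by linarith
qed

lemma lambda1_lower:
  assumes n: "DIM('a::euclidean_space) \<ge> 2" and N: "N = real DIM('a)"
    and R: "R \<ge> 10" and a: "a > 0"
    and \<sigma>: "\<sigma> = \<infinity> \<or> real_of_ereal \<sigma> \<ge> (N - 1) / 2 + 1 / a"
  shows "(N - 1)\<^sup>2 / 4 + pi\<^sup>2 / R\<^sup>2 - (2 * pi\<^sup>2 * (a + 8)) / R ^ 3 \<le> lambda1 TYPE('a) R \<sigma>"
proof -
  have R0: "R > 0"
    using R by simp
  have "(N - 1)\<^sup>2 / 4 + (pi / (R + a + 8))\<^sup>2 \<le> lambda1 TYPE('a) R \<sigma>"
    unfolding lambda1_def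
  proof (rule cInf_greatest)
    show "{lam. \<exists>u::'a \<Rightarrow> real. robin_eigenfunction R \<sigma> lam u} \<noteq> {}"
      by (rule exists_robin_eigenvalue_le[OF n N R0 refl, of \<sigma>]) blast
    show "(N - 1)\<^sup>2 / 4 + (pi / (R + a + 8))\<^sup>2 \<le> lam"
      if "lam \<in> {lam. \<exists>u::'a \<Rightarrow> real. robin_eigenfunction R \<sigma> lam u}" for lam
      using that robin_eigenvalue_ge_barrier[OF R n _ a \<sigma>] by (auto simp: N)
  qed
  moreover have "pi\<^sup>2 * (1 / R\<^sup>2 - 2 * (a + 8) / R ^ 3) \<le> pi\<^sup>2 * (1 / (R + (a + 8))\<^sup>2)"
    using R0 a by (intro mult_left_mono inverse_square_shift_ge) auto
  then have "pi\<^sup>2 / R\<^sup>2 - (2 * pi\<^sup>2 * (a + 8)) / R ^ 3 \<le> (pi / (R + a + 8))\<^sup>2"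
    by (simp add: algebra_simps power_divide)
  ultimately show ?thesis
    by linarith
qed

theorem theorem2p7:
  assumes "DIM('a::euclidean_space) \<ge> 2"
  defines "n \<equiv> real DIM('a)"
  defines "C \<equiv> pi^2 * (n^2 - 1) / 2 * integral {0<..} (\<lambda>r::real. r^2 / (sinh r)^2)"
  shows
    "(\<forall>\<sigma>::real. \<sigma> > (n - 1) / 2 \<longrightarrow>
        (\<exists>R0>0. \<exists>c0>0. \<forall>R\<ge>R0.
           (n - 1)^2 / 4 + pi^2 / R^2 - c0 / R^3 \<le> lambda1 TYPE('a) R (ereal \<sigma>) \<and>
           lambda1 TYPE('a) R (ereal \<sigma>) \<le> (n - 1)^2 / 4 + pi^2 / R^2 + C / R^3))
     \<and> (\<forall>R>0. \<forall>\<sigma>::real.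
           lambda1 TYPE('a) R (ereal \<sigma>) \<le> (n - 1)^2 / 4 + pi^2 / R^2 + C / R^3)
     \<and> (\<forall>\<sigma>::ereal. \<sigma> > ereal ((n - 1) / 2) \<longrightarrow>
           (\<lambda>R. lambda1 TYPE('a) R \<sigma> - ((n - 1)^2 / 4 + pi^2 / R^2))
             \<in> O[at_top](\<lambda>R. 1 / R^3))"
proof -
  have upper: "lambda1 TYPE('a) R \<sigma> \<le> (n - 1)^2 / 4 + pi^2 / R^2 + C / R^3" if "R > 0" for R and \<sigma> :: ereal
    by (rule lambda1_upper[OF assms(1) _ that]) (simp_all add: n_def C_def)
  have lower: "\<exists>c0>0. \<forall>R\<ge>10. (n - 1)^2 / 4 + pi^2 / R^2 - c0 / R^3 \<le> lambda1 TYPE('a) R \<sigma>"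
    if \<sigma>: "\<sigma> > ereal ((n - 1) / 2)" for \<sigma> :: ereal
  proof -
    \<comment> \<open>For finite \<open>\<sigma>\<close> the gap above \<open>(n - 1) / 2\<close> is
      exactly \<open>1 / a\<close>; in the Dirichlet case any positive \<open>a\<close> serves, and
      1 is taken.\<close>
    obtain a where a: "a > 0" "\<sigma> = \<infinity> \<or> real_of_ereal \<sigma> \<ge> (n - 1) / 2 + 1 / a"
    proof (cases \<sigma>)
      case (real t)
      then have "t - (n - 1) / 2 > 0"
        using \<sigma> by simp
      then show thesis
        using real by (intro that[of "1 / (t - (n - 1) / 2)"]) auto
    qed (use \<sigma> that[of 1] in auto)
    have "2 * pi\<^sup>2 * (a + 8) > 0"
      using a(1) by simp
    moreover have "(n - 1)^2 / 4 + pi^2 / R^2 - 2 * pi\<^sup>2 * (a + 8) / R^3 \<le> lambda1 TYPE('a) R \<sigma>"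
      if "R \<ge> 10" for R
      by (rule lambda1_lower[OF assms(1) _ that a]) (simp add: n_def)
    ultimately show ?thesis
      by blast
  qed
  have "(\<lambda>R. lambda1 TYPE('a) R \<sigma> - ((n - 1)^2 / 4 + pi^2 / R^2)) \<in> O[at_top](\<lambda>R. 1 / R^3)"
    if \<sigma>: "\<sigma> > ereal ((n - 1) / 2)" for \<sigma> :: ereal
  proof -
    from lower[OF \<sigma>] obtain c0 where c0: "c0 > 0"
      "\<And>R. R \<ge> 10 \<Longrightarrow> (n - 1)^2 / 4 + pi^2 / R^2 - c0 / R^3 \<le> lambda1 TYPE('a) R \<sigma>"
      by blast
    show ?thesis
    proof (rule bigoI)
      have "norm (lambda1 TYPE('a) R \<sigma> - ((n - 1)^2 / 4 + pi^2 / R^2)) \<le> max c0 C * norm (1 / R^3)"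
        if R: "R \<ge> 10" for R
      proof -
        have "c0 / R^3 \<le> max c0 C / R^3" "C / R^3 \<le> max c0 C / R^3"
          using R by (auto intro!: divide_right_mono)
        then have "\<bar>lambda1 TYPE('a) R \<sigma> - ((n - 1)^2 / 4 + pi^2 / R^2)\<bar> \<le> max c0 C / R^3"
          using c0(2)[OF R] upper[of R \<sigma>] R by linarith
        then show ?thesis
          using R by simp
      qed
      then show "\<forall>\<^sub>F R in at_top. norm (lambda1 TYPE('a) R \<sigma> - ((n - 1)^2 / 4 + pi^2 / R^2))
          \<le> max c0 C * norm (1 / R^3)"
        by (intro eventually_at_top_linorderI[of 10])
    qed
  qed
  moreover have "\<exists>R0>0. \<exists>c0>0. \<forall>R\<ge>R0.
      (n - 1)^2 / 4 + pi^2 / R^2 - c0 / R^3 \<le> lambda1 TYPE('a) R (ereal \<sigma>) \<and>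
      lambda1 TYPE('a) R (ereal \<sigma>) \<le> (n - 1)^2 / 4 + pi^2 / R^2 + C / R^3"
    if "\<sigma> > (n - 1) / 2" for \<sigma> :: real
  proof -
    from that lower[of "ereal \<sigma>"] obtain c0 where "c0 > 0"
      "\<And>R. R \<ge> 10 \<Longrightarrow> (n - 1)^2 / 4 + pi^2 / R^2 - c0 / R^3 \<le> lambda1 TYPE('a) R (ereal \<sigma>)"
      by auto
    then show ?thesis
      using upper by (intro exI[of _ 10] exI[of _ c0] conjI) auto
  qed
  ultimately show ?thesis
    using upper by blast
qed

end
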